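(* Let $N\ge 1$, $m\geq 2$, let $T_1,\dots,T_m$ be non-singular linear contractions on $\mathbb{R}^N$, and let $\mu$ be a Gibbs measure on $I_\infty=\{1,\dots,m\}^{\mathbb{N}}$. Let $\omega=\{\omega_{\mathbf{i}}:\mathbf{i}\in I\}$ be any family of translation vectors in $\mathbb{R}^N$ for which there is a non-empty compact set $B\subset\mathbb{R}^N$ with $T_{i_k}(B)+\omega_{i_1,\dots,i_k}\subseteq B$ for all $k\ge1$ and all $(i_1,\dots,i_k)\in I_k$, and let $\mu^\omega$ be the projection of $\mu$ onto the almost self-affine set $E^\omega$. Then $$\limsup_{r\to0}\frac{\log\mu^\omega(B(x,r))}{\log r}\le\min\Big\{\lim_{q\nearrow1}d_q,\,N\Big\}$$ for $\mu^\omega$-almost all $x\in\mathbb{R}^N$.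
   Context: A linear contraction is a linear map of Euclidean operator norm less than $1$. $B(x,r)$ is the closed ball with centre $x$ and radius $r$. Code space: $I_k=\{1,\dots,m\}^k$, $I=\bigcup_{k\ge0}I_k$, $I_\infty=\{1,\dots,m\}^{\mathbb{N}}$ (with metric $d(\mathbf{i},\mathbf{j})=2^{-n}$ for $\mathbf{i}\ne\mathbf{j}$, $n$ being the length of their maximal common initial segment); for $\mathbf{i}\in I$, $|\mathbf{i}|$ is its length and $C_{\mathbf{i}}\subset I_\infty$ is the cylinder of all infinite sequences beginning with $\mathbf{i}$; $\mathbf{i}|k$ is the initial segment of length $k$ of $\mathbf{i}\in I_\infty$. $\sigma$ is the shift $\sigma(i_1,i_2,\dots)=(i_2,i_3,\dots)$. For $\mathbf{i}=(i_1,\dots,i_k)\in I$ write $T_{\mathbf{i}}=T_{i_1}\cdots T_{i_k}$. Gibbs measure: a Borel probability measure $\mu$ on $I_\infty$ for which there are a continuous $f:I_\infty\to\mathbb{R}$, a real number $P(f)$ and $a>0$ with $$a^{-1}\le\frac{\mu(C_{\mathbf{i}|k})}{\exp\big(-kP(f)+\sum_{j=0}^{k-1}f(\sigma^j(\mathbf{i}))\big)}\le a\qquad(\mathbf{i}\in I_\infty,\ k\in\mathbb{Z}^+).$$ Almost self-affine sets and measures: for $\mathbf{i}=(i_1,i_2,\dots)\in I_\infty$ let $$x^\omega(\mathbf{i})=\omega_{i_1}+T_{i_1}\omega_{i_1,i_2}+T_{i_1}T_{i_2}\omega_{i_1,i_2,i_3}+\cdots.$$ Then $E^\omega=\{x^\omega(\mathbf{i}):\mathbf{i}\in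 I_\infty\}$, a compact set, and $\mu^\omega(A)=\mu\{\mathbf{i}:x^\omega(\mathbf{i})\in A\}$. Singular value function: for a non-singular linear contraction $T$ with singular values $1>\alpha_1\ge\cdots\ge\alpha_N>0$ and $0<s\le N$, $\phi^s(T)=\alpha_1\cdots\alpha_{l-1}\alpha_l^{\,s-l+1}$ where $l$ is the integer with $l-1<s\le l$; $\phi^0(T)=1$; and $\phi^s(T)=(\alpha_1\cdots\alpha_N)^{s/N}$ for $s\ge N$. Pressure: for $s\ge0$ and $q\ge0$, $q\ne1$, $$P(s,q)=\lim_{k\to\infty}\frac1k\,\frac{\log\sum_{|\mathbf{i}|=k}\phi^s(T_{\mathbf{i}})^{1-q}\mu(C_{\mathbf{i}})^q}{q-1}.$$ The limit exists; for each such $q$, $P(\cdot,q)$ is continuous and strictly increasing in $s$, and $d_q>0$ is the unique number with $P(d_q,q)=0$. $d_q$ is non-increasing in $q$, so $\lim_{q\nearrow1}d_q$ exists. *)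

theory Defs
  imports "HOL-Probability.Probability" "HOL-Library.Multiset"
begin

subsection \<open>Code space\<close>

text \<open>
  Infinite sequences are indexed from 0, so the term written \<open>i\<^sub>k\<close> in the
  mathematics is \<open>i (k - 1)\<close>, and the initial segment of length \<open>k\<close> is
  \<open>map i [0..<k]\<close>. Finite words are lists over \<open>{1..m}\<close>.
\<close>

definition words :: "nat \<Rightarrow> nat \<Rightarrow> nat list set" where
  "words m k = {w \<in> lists {1..m}. length w = k}"

definition code_space :: "nat \<Rightarrow> (nat \<Rightarrow> nat) set" where
  "code_space m = {i. \<forall>k. i k \<in> {1..m}}"

definition initial_seg :: "(nat \<Rightarrow> nat) \<Rightarrow> nat \<Rightarrow> nat list" where
  "initial_seg i k = map i [0..<k]"

definition cylinder :: "nat \<Rightarrow> nat list \<Rightarrow> (nat \<Rightarrow> nat) set" where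
  "cylinder m w = {i \<in> code_space m. initial_seg i (length w) = w}"

definition code_shift :: "(nat \<Rightarrow> nat) \<Rightarrow> (nat \<Rightarrow> nat)" where
  "code_shift i = (\<lambda>k. i (Suc k))"

text \<open>The least index of disagreement is the length of the maximal common initial segment.\<close>

definition code_dist :: "(nat \<Rightarrow> nat) \<Rightarrow> (nat \<Rightarrow> nat) \<Rightarrow> real" where
  "code_dist i j = (if i = j then 0 else (1/2) ^ (LEAST n. i n \<noteq> j n))"

definition code_topology :: "nat \<Rightarrow> (nat \<Rightarrow> nat) topology" where
  "code_topology m = Metric_space.mtopology (code_space m) code_dist"

lemma code_dist_less_iff: "code_dist i j < (1/2) ^ n \<longleftrightarrow> (\<forall>k\<le>n. i k = j k)"
proof (cases "i = j")
  case False
  define L where "L = (LEAST n. i n \<noteq> j n)"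
  have neq: "i L \<noteq> j L"
    unfolding L_def by (rule LeastI_ex) (use False in auto)
  have eq: "i k = j k" if "k < L" for k
    using not_less_Least[of k "\<lambda>n. i n \<noteq> j n"] that unfolding L_def by auto
  have "(1/2::real) ^ L < (1/2) ^ n \<longleftrightarrow> n < L"
    by (intro power_strict_decreasing_iff) auto
  with False neq eq show ?thesis
    unfolding code_dist_def L_def[symmetric]
    by (metis (full_types) le_less_trans not_le)
qed (simp add: code_dist_def)

lemma Metric_space_code: "Metric_space (code_space m) code_dist"
proof
  fix i j k :: "nat \<Rightarrow> nat"
  show "0 \<le> code_dist i j" "code_dist i j = code_dist j i" "code_dist i j = 0 \<longleftrightarrow> i = j"
    by (auto simp: code_dist_def eq_commute[of "i _"])
  show "code_dist i k \<le> code_dist i j + code_dist j k"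
  proof (cases "i = k \<or> i = j \<or> j = k")
    case False
    define n where "n = (LEAST n. i n \<noteq> k n)"
    have "i n \<noteq> k n"
      unfolding n_def by (rule LeastI_ex) (use False in auto)
    then have "\<not> (code_dist i j < (1/2) ^ n \<and> code_dist j k < (1/2) ^ n)"
      unfolding code_dist_less_iff by force
    moreover have "code_dist i k = (1/2) ^ n"
      using False by (simp add: code_dist_def n_def)
    moreover have "0 \<le> code_dist i j" "0 \<le> code_dist j k"
      by (auto simp: code_dist_def)
    ultimately show ?thesis by linarith
  qed (auto simp: code_dist_def)
qed


subsection \<open>Gibbs measures\<close>

definition gibbs_measure :: "nat \<Rightarrow> (nat \<Rightarrow> nat) measure \<Rightarrow> bool" where
  "gibbs_measure m \<mu> \<longleftrightarrow>
     prob_space \<mu> \<and> space \<mu> = code_space m \<and>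
     sets \<mu> = sigma_sets (code_space m) {U. openin (code_topology m) U} \<and>
     (\<exists>f P a. continuous_map (code_topology m) euclideanreal f \<and> a > 0 \<and>
        (\<forall>i\<in>code_space m. \<forall>k\<ge>1.
           let r = measure \<mu> (cylinder m (initial_seg i k)) /
                   exp (- real k * P + (\<Sum>j<k. f ((code_shift ^^ j) i)))
           in inverse a \<le> r \<and> r \<le> a))"


subsection \<open>Linear maps and the singular value function\<close>

definition linear_contraction :: "(real ^ 'n \<Rightarrow> real ^ 'n) \<Rightarrow> bool" where
  "linear_contraction T \<longleftrightarrow> linear T \<and> onorm T < 1"

definition word_map :: "(nat \<Rightarrow> real ^ 'n \<Rightarrow> real ^ 'n) \<Rightarrow> nat list \<Rightarrow> real ^ 'n \<Rightarrow> real ^ 'n" where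
  "word_map T w = foldr (\<lambda>i S. T i \<circ> S) w id"

text \<open>
  The singular values are the non-negative square roots of the eigenvalues of \<open>T\<^sup>* T\<close>, listed in
  decreasing order. Since \<open>T\<^sup>* T\<close> is self-adjoint, the multiplicity of an eigenvalue is the
  dimension of its eigenspace.
\<close>

definition singular_values :: "(real ^ 'n \<Rightarrow> real ^ 'n) \<Rightarrow> real list" where
  "singular_values T = rev (sorted_list_of_multiset
     (\<Sum>t | t \<ge> 0 \<and> (\<exists>v. v \<noteq> 0 \<and> adjoint T (T v) = t\<^sup>2 *\<^sub>R v).
        replicate_mset (dim {v. adjoint T (T v) = t\<^sup>2 *\<^sub>R v}) t))"

definition sv_fun :: "real \<Rightarrow> (real ^ 'n \<Rightarrow> real ^ 'n) \<Rightarrow> real" where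
  "sv_fun s T =
     (let N = CARD('n); \<alpha> = (\<lambda>j. singular_values T ! (j - 1)); l = nat \<lceil>s\<rceil>
      in if s = 0 then 1
         else if s \<le> real N then (\<Prod>j=1..<l. \<alpha> j) * \<alpha> l powr (s - real l + 1)
         else (\<Prod>j=1..N. \<alpha> j) powr (s / real N))"


subsection \<open>Pressure and generalised dimensions\<close>

definition pressure ::
    "nat \<Rightarrow> (nat \<Rightarrow> real ^ 'n \<Rightarrow> real ^ 'n) \<Rightarrow> (nat \<Rightarrow> nat) measure \<Rightarrow> real \<Rightarrow> real \<Rightarrow> real" where
  "pressure m T \<mu> s q = lim (\<lambda>k. 1 / real k *
     (ln (\<Sum>w\<in>words m k. sv_fun s (word_map T w) powr (1 - q) * measure \<mu> (cylinder m w) powr q)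
      / (q - 1)))"

definition gen_dim ::
    "nat \<Rightarrow> (nat \<Rightarrow> real ^ 'n \<Rightarrow> real ^ 'n) \<Rightarrow> (nat \<Rightarrow> nat) measure \<Rightarrow> real \<Rightarrow> real" where
  "gen_dim m T \<mu> q = (THE d. d > 0 \<and> pressure m T \<mu> d q = 0)"


subsection \<open>Almost self-affine measures\<close>

definition code_proj ::
    "(nat \<Rightarrow> real ^ 'n \<Rightarrow> real ^ 'n) \<Rightarrow> (nat list \<Rightarrow> real ^ 'n) \<Rightarrow> (nat \<Rightarrow> nat) \<Rightarrow> real ^ 'n" where
  "code_proj T \<omega> i = (\<Sum>k. word_map T (initial_seg i k) (\<omega> (initial_seg i (Suc k))))"

definition proj_measure ::
    "(nat \<Rightarrow> real ^ 'n \<Rightarrow> real ^ 'n) \<Rightarrow> (nat list \<Rightarrow> real ^ 'n) \<Rightarrow> (nat \<Rightarrow> nat) measure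
     \<Rightarrow> (real ^ 'n) measure" where
  "proj_measure T \<omega> \<mu> = distr \<mu> borel (code_proj T \<omega>)"

text \<open>
  The case distinction implements \<open>log 0 = -\<infinity>\<close>, so that a ball of measure zero
  and radius less than 1 contributes \<open>\<infinity>\<close>, although \<open>ln 0 = 0\<close> in HOL.
\<close>

definition upper_local_dim :: "(real ^ 'n) measure \<Rightarrow> real ^ 'n \<Rightarrow> ereal" where
  "upper_local_dim \<nu> x = Limsup (at_right 0)
     (\<lambda>r. if measure \<nu> (cball x r) = 0 then \<infinity>
          else ereal (ln (measure \<nu> (cball x r)) / ln r))"

end

(*
  Let D be the limit of the generalised dimensions and D < s <= N. Choose q < 1 with d_q < s, so that the
  sums of phi^s(T_w)^(1-q) mu(C_w)^q over words w of length k are summable in k. The image of the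
  cylinder C_w lies in an ellipsoid similar to T_w(B(0,1)), which is covered by about
  phi^s(T_w) / alpha^s balls of radius alpha = alpha_l(T_w), where l = ceiling s. Hence the points of
  C_w whose ball of radius comparable to alpha has measure below alpha^s have total measure at most
  min (mu(C_w), C phi^s(T_w)) <= C' phi^s(T_w)^(1-q) mu(C_w)^q, and Borel-Cantelli gives
  mu^omega(B(x,r)) >= r^s up to constants along the radii r = alpha_l(T_{i|k}). Consecutive radii have
  bounded ratio, which yields the bound s for the upper local dimension. The bound N is the same
  argument with the whole space as the only cylinder and dyadic radii.

  The generalised dimensions are given by a definite description and a limit, so that the pressure has to
  be shown to exist (Fekete), to be strictly increasing and Lipschitz in s, and monotone in q (Lyapunov's
  moment inequality).
*)
theory Submission
  imports Defs
begin


subsection \<open>Spectral theorem and singular value decomposition\<close>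

text \<open>The singular values are given as a multiset of roots of eigenvalues, each repeated by
  the dimension of its eigenspace. All estimates use orthonormal bases adapted to them, so the
  spectral theorem has to come before everything else. The function phi^s is obtained as
  submultiplicative up to a constant; adding the logarithm of that constant restores subadditivity
  without changing the growth rate. The Gibbs property acts through the comparison of mu(C_uw) with
  mu(C_u) mu(C_w): the upper estimate makes the pressure exist, the lower one forces cylinder
  measures to decay exponentially, so that P(0,q) < 0 and d_q is positive. The radii
  alpha_l(T_{i|k}) depend on the code i, so estimates along them reach all small radii only if they
  cannot drop abruptly. This is what the minimax principle is for: appending a letter multiplies
  alpha_l by at least a fixed lower expansion bound of the maps. The constants left over are
  absorbed by passing from the exponent s to any t > s.\<close>

lemma self_adjoint_eigenvector:
  fixes A :: "'a::euclidean_space \<Rightarrow> 'a"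
  assumes A: "linear A" and adj: "\<And>x y. A x \<bullet> y = x \<bullet> A y"
    and S: "subspace S" "A ` S \<subseteq> S" "S \<noteq> {0}"
  obtains x where "x \<in> S" "norm x = 1" "A x = (x \<bullet> A x) *\<^sub>R x"
proof -
  obtain z where z: "z \<in> S" "z \<noteq> 0"
    using S subspace_0 by blast
  have "compact (sphere 0 1 \<inter> S)"
    using closed_subspace[OF S(1)] compact_Int_closed compact_sphere by blast
  moreover have "z /\<^sub>R norm z \<in> sphere 0 1 \<inter> S"
    using z S(1) by (simp add: subspace_scale)
  moreover have "continuous_on (sphere 0 1 \<inter> S) (\<lambda>x. x \<bullet> A x)"
    by (intro continuous_intros linear_continuous_on_compose[OF _ A])
  ultimately obtain x where x: "x \<in> sphere 0 1 \<inter> S"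
    and max: "\<And>y. y \<in> sphere 0 1 \<inter> S \<Longrightarrow> y \<bullet> A y \<le> x \<bullet> A x"
    using continuous_attains_sup[of "sphere 0 1 \<inter> S" "\<lambda>x. x \<bullet> A x"] by blast
  define l where "l = x \<bullet> A x"
  have nx: "norm x = 1" "x \<bullet> x = 1" and xS: "x \<in> S"
    using x by (auto simp: dot_square_norm)
  have bound: "y \<bullet> A y \<le> l * (y \<bullet> y)" if "y \<in> S" for y
  proof (cases "y = 0")
    case False
    then have "(y /\<^sub>R norm y) \<bullet> A (y /\<^sub>R norm y) \<le> l"
      unfolding l_def using that S(1) by (intro max) (simp add: subspace_scale)
    then show ?thesis
      using False
      by (simp add: linear_scale[OF A] dot_square_norm field_simps power2_eq_square)
  qed simp
  have orth: "y \<bullet> A x = 0" if y: "y \<in> S" "y \<bullet> x = 0" for y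
  proof (rule ccontr)
    assume ne: "y \<bullet> A x \<noteq> 0"
    define c where "c = l * (y \<bullet> y) - y \<bullet> A y"
    define d where "d = y \<bullet> A x"
    \<comment> \<open>The quotient \<open>y \<bullet> A y / (y \<bullet> y)\<close> is maximal at
      \<open>x\<close>, so moving from \<open>x\<close> in the direction \<open>y\<close> cannot
      gain; \<open>2 * t * d\<close> is the first-order term.\<close>
    have ineq: "2 * t * d \<le> t\<^sup>2 * c" for t :: real
    proof -
      have "x + t *\<^sub>R y \<in> S"
        using y S(1) xS by (simp add: subspace_add subspace_scale)
      from bound[OF this]
      have "l + t * (x \<bullet> A y) + t * d + t * t * (y \<bullet> A y) \<le> l * (1 + t * t * (y \<bullet> y))"
        using y nx
        by (simp add: linear_add[OF A] linear_scale[OF A] inner_add_left inner_add_right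
            inner_commute[of x y] d_def l_def algebra_simps)
      moreover have "x \<bullet> A y = d"
        unfolding d_def using adj[of x y] by (simp add: inner_commute)
      ultimately show ?thesis
        by (simp add: c_def power2_eq_square algebra_simps)
    qed
    \<comment> \<open>With the step \<open>d / K\<close> the quadratic term is at most half the
      linear one; the 1 keeps \<open>K\<close> positive.\<close>
    define K where "K = \<bar>c\<bar> + 1"
    have "2 * (d / K) * d \<le> (d / K)\<^sup>2 * c"
      by (rule ineq)
    also have "\<dots> \<le> (d / K)\<^sup>2 * K"
      by (intro mult_left_mono) (auto simp: K_def)
    finally have "2 * d\<^sup>2 / K \<le> d\<^sup>2 / K"
      by (simp add: K_def power2_eq_square divide_simps split: if_splits)
    moreover have "d\<^sup>2 / K > 0"
      using ne by (simp add: K_def d_def)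
    ultimately show False by simp
  qed
  \<comment> \<open>The part of \<open>A x\<close> orthogonal to \<open>x\<close>. It lies in
    \<open>S\<close>, so it is orthogonal to \<open>A x\<close> and thereby to itself.\<close>
  define w where "w = A x - l *\<^sub>R x"
  have "w \<in> S"
    unfolding w_def using S xS by (auto intro!: subspace_diff subspace_scale)
  moreover have wx: "w \<bullet> x = 0"
    using nx by (simp add: w_def l_def inner_diff_left inner_commute[of "A x" x])
  ultimately have "w \<bullet> A x = 0"
    by (rule orth)
  then have "w \<bullet> w = 0"
    using wx by (subst (2) w_def) (simp add: inner_diff_right)
  then have "A x = (x \<bullet> A x) *\<^sub>R x"
    by (simp add: w_def l_def)
  with that xS nx show thesis by blast
qed

lemma card_orthonormal_le:
  fixes B :: "'a::euclidean_space set"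
  assumes "pairwise orthogonal B" "\<forall>b\<in>B. norm b = 1"
  shows "independent B" "finite B" "card B \<le> DIM('a)"
proof -
  show ind: "independent B"
    using assms by (intro pairwise_orthogonal_independent) force+
  show "finite B" "card B \<le> DIM('a)"
    using independent_bound[OF ind] by auto
qed

text \<open>Take an orthonormal set of eigenvectors of greatest cardinality. Self-adjointness makes
  its orthogonal complement invariant, and a nonzero complement would contain one more unit
  eigenvector.\<close>

theorem spectral_theorem:
  fixes A :: "'a::euclidean_space \<Rightarrow> 'a"
  assumes A: "linear A" and adj: "\<And>x y. A x \<bullet> y = x \<bullet> A y"
  obtains B where "pairwise orthogonal B" "\<forall>b\<in>B. norm b = 1" "span B = UNIV"
    "finite B" "card B = DIM('a)" "\<And>b. b \<in> B \<Longrightarrow> A b = (b \<bullet> A b) *\<^sub>R b"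
proof -
  define P where "P B \<longleftrightarrow> pairwise orthogonal B \<and> (\<forall>b\<in>B. norm b = 1) \<and>
    (\<forall>b\<in>B. A b = (b \<bullet> A b) *\<^sub>R b)" for B
  have P0: "P {}" by (simp add: P_def)
  have bnd: "\<forall>B. P B \<longrightarrow> card B < Suc DIM('a)"
    using card_orthonormal_le(3) by (auto simp: P_def less_Suc_eq_le)
  obtain B where B: "P B" and max: "\<And>B'. P B' \<Longrightarrow> card B' \<le> card B"
    using ex_has_greatest_nat[of P "{}" card "Suc DIM('a)"] P0 bnd by (metis less_imp_le)
  have Bo: "pairwise orthogonal B" "\<forall>b\<in>B. norm b = 1"
    and Be: "\<And>b. b \<in> B \<Longrightarrow> A b = (b \<bullet> A b) *\<^sub>R b"
    using B by (auto simp: P_def)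
  note Bf = card_orthonormal_le[OF Bo]
  define S where "S = {y. \<forall>b\<in>B. orthogonal b y}"
  have subS: "subspace S"
    unfolding S_def by (rule subspace_orthogonal_to_vectors)
  have "A ` S \<subseteq> S"
  proof clarify
    fix y assume "y \<in> S"
    then have "b \<bullet> A y = 0" if "b \<in> B" for b
      using adj[of b y] Be[OF that] that by (metis S_def inner_scaleR_left mem_Collect_eq mult_zero_right orthogonal_def)
    then show "A y \<in> S"
      by (simp add: S_def orthogonal_def)
  qed
  have "S = {0}"
  proof (rule ccontr)
    assume "S \<noteq> {0}"
    then obtain x where x: "x \<in> S" "norm x = 1" "A x = (x \<bullet> A x) *\<^sub>R x"
      using self_adjoint_eigenvector[OF A adj subS \<open>A ` S \<subseteq> S\<close>] by blast
    have "x \<notin> B"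
      using x(1,2) by (auto simp: S_def orthogonal_def)
    moreover have "P (insert x B)"
      using B x by (auto simp: P_def S_def pairwise_insert orthogonal_commute)
    ultimately show False
      using max[of "insert x B"] Bf(2) by simp
  qed
  have "span B = UNIV"
  proof (rule ccontr)
    assume "span B \<noteq> UNIV"
    then obtain a where a: "a \<noteq> 0" "\<forall>x\<in>span B. a \<bullet> x = 0"
      using span_not_UNIV_orthogonal by blast
    then have "a \<in> S"
      by (auto simp: S_def orthogonal_def inner_commute span_base)
    with a \<open>S = {0}\<close> show False by simp
  qed
  moreover from this have "card B = DIM('a)"
    using Bf(1) by (metis dim_UNIV dim_span_eq_card_independent)
  ultimately show thesis
    using that Bo Be Bf(2) by blast
qed

lemma inner_orthonormal_sum:
  fixes B :: "'a::euclidean_space set"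
  assumes "pairwise orthogonal B" "\<forall>b\<in>B. norm b = 1" "finite B" "c \<in> B"
  shows "(\<Sum>b\<in>B. f b *\<^sub>R b) \<bullet> c = f c"
proof -
  have "(\<Sum>b\<in>B. f b *\<^sub>R b) \<bullet> c = (\<Sum>b\<in>B. if b = c then f c else 0)"
    unfolding inner_sum_left
  proof (rule sum.cong)
    fix b assume "b \<in> B"
    then show "f b *\<^sub>R b \<bullet> c = (if b = c then f c else 0)"
      using assms(1,2,4) by (auto simp: pairwise_def orthogonal_def dot_square_norm)
  qed simp
  then show ?thesis using assms(3,4) by simp
qed

lemma orthonormal_basis_expansion:
  fixes B :: "'a::euclidean_space set"
  assumes "pairwise orthogonal B" "\<forall>b\<in>B. norm b = 1" "span B = UNIV" "finite B"
  shows "x = (\<Sum>b\<in>B. (x \<bullet> b) *\<^sub>R b)"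
proof -
  have "x \<in> span B" using assms(3) by simp
  then obtain f where "x = (\<Sum>b\<in>B. f b *\<^sub>R b)"
    unfolding span_finite[OF assms(4)] by auto
  then show ?thesis
    using inner_orthonormal_sum[OF assms(1,2,4)] by simp
qed

text \<open>Comparing coordinates of \<open>A v\<close> and \<open>c v\<close> kills those belonging
  to other eigenvalues. This turns the eigenspace dimensions that occur in
  \<open>singular_values\<close> into numbers of basis vectors.\<close>

lemma eigenspace_orthonormal_eigenbasis:
  fixes A :: "'a::euclidean_space \<Rightarrow> 'a"
  assumes A: "linear A"
    and B: "pairwise orthogonal B" "\<forall>b\<in>B. norm b = 1" "span B = UNIV" "finite B"
    and ev: "\<And>b. b \<in> B \<Longrightarrow> A b = e b *\<^sub>R b"
  shows "{v. A v = c *\<^sub>R v} = span {b \<in> B. e b = c}"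
proof (intro subset_antisym subsetI)
  fix v assume "v \<in> span {b \<in> B. e b = c}"
  moreover have "subspace {v. A v = c *\<^sub>R v}"
    by (auto simp: subspace_def linear_add[OF A] linear_scale[OF A] linear_0[OF A]
        scaleR_add_right)
  ultimately have "v \<in> {v. A v = c *\<^sub>R v}"
    using span_minimal[of "{b \<in> B. e b = c}" "{v. A v = c *\<^sub>R v}"] ev by auto
  then show "v \<in> {v. A v = c *\<^sub>R v}" .
next
  fix v assume v: "v \<in> {v. A v = c *\<^sub>R v}"
  note ex = orthonormal_basis_expansion[OF B]
  note inner = inner_orthonormal_sum[OF B(1,2,4)]
  have coeff: "(v \<bullet> b) = 0" if b: "b \<in> B" "e b \<noteq> c" for b
  proof -
    have "A v = A (\<Sum>b\<in>B. (v \<bullet> b) *\<^sub>R b)"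
      using ex[of v] by simp
    also have "\<dots> = (\<Sum>b\<in>B. ((v \<bullet> b) * e b) *\<^sub>R b)"
      by (simp add: linear_sum[OF A] linear_scale[OF A] ev)
    finally have "A v \<bullet> b = (v \<bullet> b) * e b"
      using inner[OF b(1)] by simp
    then show ?thesis using v b by auto
  qed
  have "v = (\<Sum>b\<in>B. (v \<bullet> b) *\<^sub>R b)"
    by (rule ex)
  also have "\<dots> = (\<Sum>b\<in>{b \<in> B. e b = c}. (v \<bullet> b) *\<^sub>R b)"
    using B(4) coeff by (intro sum.mono_neutral_right) auto
  also have "\<dots> \<in> span {b \<in> B. e b = c}"
    by (intro span_sum span_scale span_base)
  finally show "v \<in> span {b \<in> B. e b = c}" .
qed

text \<open>Indices run over \<open>{..<CARD('n)}\<close>, so \<open>a j\<close> is the singular value \<open>\<alpha>\<^sub>j\<^sub>+\<^sub>1\<close>.\<close>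

definition svd :: "(real ^ 'n \<Rightarrow> real ^ 'n) \<Rightarrow> (nat \<Rightarrow> real ^ 'n) \<Rightarrow> (nat \<Rightarrow> real ^ 'n) \<Rightarrow>
    (nat \<Rightarrow> real) \<Rightarrow> bool" where
  "svd T v u a \<longleftrightarrow>
     (\<forall>i<CARD('n). \<forall>j<CARD('n). v i \<bullet> v j = (if i = j then 1 else 0)) \<and>
     (\<forall>i<CARD('n). \<forall>j<CARD('n). u i \<bullet> u j = (if i = j then 1 else 0)) \<and>
     (\<forall>x. x = (\<Sum>j<CARD('n). (x \<bullet> v j) *\<^sub>R v j)) \<and>
     (\<forall>j<CARD('n). T (v j) = a j *\<^sub>R u j \<and> a j > 0) \<and>
     (\<forall>i j. i \<le> j \<longrightarrow> j < CARD('n) \<longrightarrow> a j \<le> a i)"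

theorem singular_values_svd:
  fixes T :: "real ^ 'n \<Rightarrow> real ^ 'n"
  assumes T: "linear T" and inj: "inj T"
  obtains v u where "svd T v u (\<lambda>j. singular_values T ! j)"
proof -
  define A where "A = (\<lambda>x. adjoint T (T x))"
  have A: "linear A"
    unfolding A_def using adjoint_linear[OF T] T linear_compose[of T "adjoint T"] by (simp add: o_def)
  have Ain: "A x \<bullet> y = T x \<bullet> T y" "x \<bullet> A y = T x \<bullet> T y" for x y
    using adjoint_works[OF T] by (auto simp: A_def adjoint_clauses[OF T])
  obtain B where B: "pairwise orthogonal B" "\<forall>b\<in>B. norm b = 1" "span B = UNIV"
    "finite B" and cardB: "card B = DIM(real^'n)" and ev0: "\<And>b. b \<in> B \<Longrightarrow> A b = (b \<bullet> A b) *\<^sub>R b"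
    using spectral_theorem[OF A] Ain by metis
  have cB: "card B = CARD('n)"
    using cardB by simp
  define sv where "sv b = norm (T b)" for b
  have ev: "A b = ((sv b)\<^sup>2) *\<^sub>R b" if "b \<in> B" for b
  proof -
    have "b \<bullet> A b = (sv b)\<^sup>2"
      by (simp add: Ain sv_def dot_square_norm)
    with ev0[OF that] show ?thesis by metis
  qed
  have dimE: "dim {v. A v = t\<^sup>2 *\<^sub>R v} = card {b \<in> B. sv b = t}" if "t \<ge> 0" for t
  proof -
    have "{v. A v = t\<^sup>2 *\<^sub>R v} = span {b \<in> B. (sv b)\<^sup>2 = t\<^sup>2}"
      by (rule eigenspace_orthonormal_eigenbasis[OF A B ev])
    also have "{b \<in> B. (sv b)\<^sup>2 = t\<^sup>2} = {b \<in> B. sv b = t}"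
      using that by (auto simp: sv_def power2_eq_iff_nonneg)
    finally have "dim {v. A v = t\<^sup>2 *\<^sub>R v} = dim {b \<in> B. sv b = t}" by simp
    also have "\<dots> = card {b \<in> B. sv b = t}"
      by (rule dim_eq_card_independent, rule independent_mono[OF card_orthonormal_le(1)[OF B(1,2)]]) auto
    finally show ?thesis .
  qed
  define R where "R = {t. t \<ge> 0 \<and> (\<exists>v. v \<noteq> 0 \<and> A v = t\<^sup>2 *\<^sub>R v)}"
  have Riff: "t \<in> R \<longleftrightarrow> t \<in> sv ` B" for t
  proof
    assume "t \<in> R"
    then obtain v where t: "t \<ge> 0" and v: "v \<noteq> 0" "A v = t\<^sup>2 *\<^sub>R v"
      by (auto simp: R_def)
    have "{v. A v = t\<^sup>2 *\<^sub>R v} \<noteq> {0}" "{v. A v = t\<^sup>2 *\<^sub>R v} \<noteq> {}" using v by auto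
    then have "dim {v. A v = t\<^sup>2 *\<^sub>R v} \<noteq> 0"
      unfolding dim_eq_0 using v by auto
    then have "{b \<in> B. sv b = t} \<noteq> {}"
      unfolding dimE[OF t] by (metis card.empty)
    then show "t \<in> sv ` B" by auto
  next
    assume "t \<in> sv ` B"
    then obtain b where b: "b \<in> B" "t = sv b" by auto
    then have "b \<noteq> 0" using B(2) by auto
    then show "t \<in> R" using b ev by (auto simp: R_def sv_def)
  qed
  have "finite R"
    using Riff B(4) by (metis finite_imageI subsetI finite_subset)
  have mset: "(\<Sum>t\<in>R. replicate_mset (dim {v. A v = t\<^sup>2 *\<^sub>R v}) t) = image_mset sv (mset_set B)"
  proof (rule multiset_eqI)
    fix t
    have "count (\<Sum>t\<in>R. replicate_mset (dim {v. A v = t\<^sup>2 *\<^sub>R v}) t) t =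
      (\<Sum>s\<in>R. if s = t then dim {v. A v = t\<^sup>2 *\<^sub>R v} else 0)"
      by (auto simp: count_sum intro!: sum.cong)
    also have "\<dots> = (if t \<in> R then dim {v. A v = t\<^sup>2 *\<^sub>R v} else 0)"
      using \<open>finite R\<close> by simp
    also have "\<dots> = card {b \<in> B. sv b = t}"
    proof (cases "t \<in> R")
      case True
      then show ?thesis using dimE[of t] by (simp add: R_def)
    next
      case False
      then have "{b \<in> B. sv b = t} = {}" unfolding Riff by auto
      then show ?thesis using False by (metis card.empty)
    qed
    also have "\<dots> = count (image_mset sv (mset_set B)) t"
    proof -
      have "sv -` {t} \<inter> B = {b \<in> B. sv b = t}" by auto
      then show ?thesis using B(4) by (simp add: count_image_mset)
    qed
    finally show "count (\<Sum>t\<in>R. replicate_mset (dim {v. A v = t\<^sup>2 *\<^sub>R v}) t) t =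
      count (image_mset sv (mset_set B)) t" .
  qed
  obtain xs where xs: "set xs = B" "distinct xs"
    using finite_distinct_list[OF B(4)] by auto
  \<comment> \<open>Sorting the basis instead of the values keeps each singular value attached to
    its vector.\<close>
  define bs where "bs = rev (sort_key sv xs)"
  have bs: "set bs = B" "distinct bs" "length bs = CARD('n)"
    using xs cB distinct_card[OF xs(2)] by (auto simp: bs_def)
  have "singular_values T = rev (sorted_list_of_multiset (image_mset sv (mset xs)))"
    unfolding singular_values_def
    using mset mset_set_set[OF xs(2)] xs(1) by (simp add: R_def A_def)
  also have "image_mset sv (mset xs) = mset (map sv (sort_key sv xs))"
    by simp
  also have "sorted_list_of_multiset \<dots> = map sv (sort_key sv xs)"
    unfolding sorted_list_of_multiset_mset by (rule sorted_sort_id) simp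
  finally have svals: "singular_values T = map sv bs"
    by (simp add: bs_def rev_map)
  have sorted: "sorted (rev (singular_values T))"
    by (simp add: svals bs_def rev_map)
  define v where "v j = bs ! j" for j
  define u where "u j = T (v j) /\<^sub>R sv (v j)" for j
  have vB: "v j \<in> B" if "j < CARD('n)" for j
    using that bs by (metis nth_mem v_def)
  have a: "singular_values T ! j = sv (v j)" if "j < CARD('n)" for j
    using that bs(3) by (simp add: svals v_def)
  have pos: "sv (v j) > 0" if "j < CARD('n)" for j
  proof -
    have "v j \<noteq> 0" using B(2) vB[OF that] by auto
    then have "T (v j) \<noteq> 0" using inj T by (metis linear_injective_0)
    then show ?thesis by (simp add: sv_def)
  qed
  have vo: "v i \<bullet> v j = (if i = j then 1 else 0)" if "i < CARD('n)" "j < CARD('n)" for i j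
  proof (cases "i = j")
    case True
    then show ?thesis using B(2) vB[OF that(1)] by (simp add: dot_square_norm)
  next
    case False
    then have "v i \<noteq> v j"
      using that bs(2,3) by (simp add: v_def nth_eq_iff_index_eq)
    then show ?thesis
      using False B(1) vB that by (auto simp: pairwise_def orthogonal_def)
  qed
  have uo: "u i \<bullet> u j = (if i = j then 1 else 0)" if ij: "i < CARD('n)" "j < CARD('n)" for i j
  proof -
    have "T (v i) \<bullet> T (v j) = (sv (v i))\<^sup>2 * (v i \<bullet> v j)"
      using ev[OF vB[OF ij(1)]] Ain(1)[of "v i" "v j"] by simp
    then show ?thesis
      using vo[OF ij] pos[OF ij(1)] pos[OF ij(2)]
      by (simp add: u_def power2_eq_square field_simps)
  qed
  have bij: "bij_betw v {..<CARD('n)} B"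
    using bij_betw_nth[OF bs(2), of "{..<CARD('n)}" B] bs(1,3) by (simp add: v_def[abs_def])
  have expand: "x = (\<Sum>j<CARD('n). (x \<bullet> v j) *\<^sub>R v j)" for x
    using orthonormal_basis_expansion[OF B, of x]
      sum.reindex_bij_betw[OF bij, of "\<lambda>b. (x \<bullet> b) *\<^sub>R b"] by simp
  have decr: "singular_values T ! j \<le> singular_values T ! i" if "i \<le> j" "j < CARD('n)" for i j
    using sorted_rev_nth_mono[OF sorted that(1)] that(2) bs(3) by (simp add: svals)
  have Tv: "T (v j) = sv (v j) *\<^sub>R u j" if "j < CARD('n)" for j
    using pos[OF that] by (simp add: u_def)
  have "svd T v u (\<lambda>j. singular_values T ! j)"
    unfolding svd_def using vo uo expand decr a pos Tv by auto
  with that show thesis .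
qed


subsection \<open>The singular value function\<close>

text \<open>The exponent in phi^s of the singular value with index \<open>j\<close>, counted from 0.
  It merges the three cases of \<open>sv_fun\<close> into one product over all singular values, with
  exponents that are monotone in \<open>s\<close> and add up to \<open>s\<close>.\<close>

definition sv_exponent :: "nat \<Rightarrow> real \<Rightarrow> nat \<Rightarrow> real" where
  "sv_exponent N s j = (if s \<le> real N then max 0 (min 1 (s - real j)) else s / real N)"

lemma sv_exponent_nonneg: "0 \<le> s \<Longrightarrow> 0 \<le> sv_exponent N s j"
  by (simp add: sv_exponent_def)

lemma sv_exponent_le_one: "s \<le> real N \<Longrightarrow> sv_exponent N s j \<le> 1"
  by (simp add: sv_exponent_def)

lemma sum_sv_exponent:
  assumes "0 \<le> s" "0 < N"
  shows "(\<Sum>j<N. sv_exponent N s j) = s"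
proof -
  have "(\<Sum>j<n. max 0 (min 1 (s - real j))) = min s (real n)" for n
    using assms(1) by (induction n) auto
  then show ?thesis
    using assms by (cases "s \<le> real N") (simp_all add: sv_exponent_def)
qed

lemma sv_exponent_mono:
  assumes "0 \<le> s" "s \<le> t" "0 < N"
  shows "sv_exponent N s j \<le> sv_exponent N t j"
proof (cases "t \<le> real N")
  case False
  moreover have "1 \<le> t / real N" using False assms by simp
  then have "max 0 (min 1 (s - real j)) \<le> t / real N" by linarith
  ultimately show ?thesis
    using assms by (auto simp: sv_exponent_def divide_right_mono simp del: max.bounded_iff)
qed (use assms in \<open>auto simp: sv_exponent_def\<close>)

lemma svd_pos: "svd T v u a \<Longrightarrow> j < CARD('n) \<Longrightarrow> 0 < a j"
  for T :: "real ^ 'n \<Rightarrow> real ^ 'n"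
  by (simp add: svd_def)

lemma sv_fun_eq_prod:
  fixes T :: "real ^ 'n \<Rightarrow> real ^ 'n"
  assumes svd: "svd T v u (\<lambda>j. singular_values T ! j)" and s: "0 \<le> s"
  shows "sv_fun s T = (\<Prod>j<CARD('n). (singular_values T ! j) powr sv_exponent CARD('n) s j)"
proof -
  note pos = svd_pos[OF svd]
  consider "s = 0" | "0 < s" "s \<le> CARD('n)" | "s > CARD('n)"
    using s by linarith
  then show ?thesis
  proof cases
    case 1
    have "singular_values T ! j powr sv_exponent CARD('n) 0 j = 1" if "j < CARD('n)" for j
      using pos[OF that] by (simp add: sv_exponent_def)
    then show ?thesis
      using 1 by (simp add: sv_fun_def)
  next
    case 2
    \<comment> \<open>\<open>Suc l\<close> is the integer called l in the definition, so the
      fractional exponent becomes \<open>s - real l\<close>.\<close>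
    obtain l where l: "nat \<lceil>s\<rceil> = Suc l"
      using 2 by (metis zero_less_ceiling zero_less_nat_eq gr0_conv_Suc)
    then have ls: "real l < s" "s \<le> real l + 1"
      by linarith+
    have lN: "Suc l \<le> CARD('n)"
      using 2 l by linarith
    have "(\<Prod>j<CARD('n). (singular_values T ! j) powr sv_exponent CARD('n) s j) =
      (\<Prod>j<Suc l. (singular_values T ! j) powr sv_exponent CARD('n) s j)"
    proof (rule prod.mono_neutral_right)
      show "\<forall>j\<in>{..<CARD('n)} - {..<Suc l}. singular_values T ! j powr sv_exponent CARD('n) s j = 1"
      proof
        fix j assume j: "j \<in> {..<CARD('n)} - {..<Suc l}"
        then have "sv_exponent CARD('n) s j = 0"
          using ls 2 by (simp add: sv_exponent_def max_def min_def not_less)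
        then show "singular_values T ! j powr sv_exponent CARD('n) s j = 1"
          using pos[of j] j by simp
      qed
    qed (use lN in auto)
    also have "\<dots> = (\<Prod>j<l. singular_values T ! j) * singular_values T ! l powr (s - real l)"
    proof -
      have "singular_values T ! j powr sv_exponent CARD('n) s j = singular_values T ! j"
        if "j < l" for j
      proof -
        have "real j + 1 \<le> real l" using that by linarith
        then have "sv_exponent CARD('n) s j = 1"
          using ls 2 by (simp add: sv_exponent_def max_def min_def)
        then show ?thesis using pos[of j] lN that by simp
      qed
      moreover have "sv_exponent CARD('n) s l = s - real l"
        using ls 2 by (simp add: sv_exponent_def)
      ultimately show ?thesis by simp
    qed
    also have "(\<Prod>j<l. singular_values T ! j) = (\<Prod>j=1..<Suc l. singular_values T ! (j - 1))"
      by (rule prod.reindex_bij_witness[of _ "\<lambda>j. j - 1" Suc]) auto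
    finally show ?thesis
      using 2 l by (simp add: sv_fun_def Let_def)
  next
    case 3
    have "(\<Prod>j=1..CARD('n). singular_values T ! (j - 1)) = (\<Prod>j<CARD('n). singular_values T ! j)"
      by (rule prod.reindex_bij_witness[of _ Suc "\<lambda>j. j - 1"]) auto
    then show ?thesis
      using 3 by (simp add: sv_fun_def sv_exponent_def Let_def prod_powr_distrib)
  qed
qed

lemma sv_fun_pos:
  fixes T :: "real ^ 'n \<Rightarrow> real ^ 'n"
  assumes "linear T" "inj T" "0 \<le> s"
  shows "0 < sv_fun s T"
proof -
  obtain v u where svd: "svd T v u (\<lambda>j. singular_values T ! j)"
    using singular_values_svd assms by blast
  show ?thesis
    unfolding sv_fun_eq_prod[OF svd assms(3)] using svd_pos[OF svd] by (intro prod_pos) force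
qed

lemma svd_norm:
  fixes T :: "real ^ 'n \<Rightarrow> real ^ 'n"
  assumes "svd T v u a" "j < CARD('n)"
  shows "norm (v j) = 1" "norm (u j) = 1" "norm (T (v j)) = a j"
  using assms by (auto simp: svd_def norm_eq_1)

lemma singular_value_bounds:
  fixes T :: "real ^ 'n \<Rightarrow> real ^ 'n"
  assumes "linear T" "inj T" "j < CARD('n)"
    and "\<And>x. c * norm x \<le> norm (T x)" "\<And>x. norm (T x) \<le> b * norm x"
  shows "c \<le> singular_values T ! j" "singular_values T ! j \<le> b" "0 < singular_values T ! j"
proof -
  obtain v u where svd: "svd T v u (\<lambda>j. singular_values T ! j)"
    using singular_values_svd assms by blast
  show "c \<le> singular_values T ! j" "singular_values T ! j \<le> b" "0 < singular_values T ! j"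
    using assms(4)[of "v j"] assms(5)[of "v j"] svd_norm[OF svd assms(3)] svd_pos[OF svd assms(3)]
    by auto
qed

text \<open>Raising \<open>s\<close> to \<open>t\<close> raises each exponent by some
  \<open>d j \<ge> 0\<close>, and these add up to \<open>t - s\<close>; every factor
  \<open>a j powr d j\<close> lies between the corresponding powers of \<open>c\<close> and
  \<open>b\<close>.\<close>

lemma sv_fun_increment:
  fixes T :: "real ^ 'n \<Rightarrow> real ^ 'n"
  assumes T: "linear T" "inj T" and "0 < c"
    and bnd: "\<And>x. c * norm x \<le> norm (T x)" "\<And>x. norm (T x) \<le> b * norm x"
    and st: "0 \<le> s" "s \<le> t"
  shows "c powr (t - s) * sv_fun s T \<le> sv_fun t T" "sv_fun t T \<le> b powr (t - s) * sv_fun s T"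
proof -
  define a where "a j = singular_values T ! j" for j
  define d where "d j = sv_exponent CARD('n) t j - sv_exponent CARD('n) s j" for j
  obtain v u where svd: "svd T v u (\<lambda>j. singular_values T ! j)"
    using singular_values_svd T by blast
  have ab: "c \<le> a j" "a j \<le> b" "0 < a j" if "j < CARD('n)" for j
    using singular_value_bounds[OF T that bnd] by (auto simp: a_def)
  have b: "0 < b" using ab[of 0] by simp
  have d: "0 \<le> d j" for j
    using sv_exponent_mono[OF st] by (simp add: d_def)
  have sumd: "(\<Sum>j<CARD('n). d j) = t - s"
    using st by (simp add: d_def sum_subtractf sum_sv_exponent)
  have "sv_fun t T = (\<Prod>j<CARD('n). a j powr d j * a j powr sv_exponent CARD('n) s j)"
    using st sv_fun_eq_prod[OF svd, of t] by (simp add: a_def d_def flip: powr_add)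
  also have "\<dots> = (\<Prod>j<CARD('n). a j powr d j) * sv_fun s T"
    using st sv_fun_eq_prod[OF svd, of s] by (simp add: a_def prod.distrib)
  finally have eq: "sv_fun t T = (\<Prod>j<CARD('n). a j powr d j) * sv_fun s T" .
  have "c powr (t - s) = (\<Prod>j<CARD('n). c powr d j)"
    using \<open>0 < c\<close> by (simp add: powr_sum flip: sumd)
  also have "\<dots> \<le> (\<Prod>j<CARD('n). a j powr d j)"
    using ab \<open>0 < c\<close> d by (intro prod_mono) (simp add: powr_mono2)
  finally show "c powr (t - s) * sv_fun s T \<le> sv_fun t T"
    unfolding eq using sv_fun_pos[OF T, of s] st by (intro mult_right_mono) auto
  have "(\<Prod>j<CARD('n). a j powr d j) \<le> (\<Prod>j<CARD('n). b powr d j)"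
    using ab d by (intro prod_mono) (simp add: powr_mono2 less_imp_le)
  also have "\<dots> = b powr (t - s)"
    using b by (simp add: powr_sum flip: sumd)
  finally show "sv_fun t T \<le> b powr (t - s) * sv_fun s T"
    unfolding eq using sv_fun_pos[OF T, of s] st by (intro mult_right_mono) auto
qed

section \<open>Covering and packing numbers of ellipsoids\<close>

lemma svd_apply:
  fixes T :: "real ^ 'n \<Rightarrow> real ^ 'n"
  assumes T: "linear T" and svd: "svd T v u a"
  shows "T x = (\<Sum>j<CARD('n). (a j * (x \<bullet> v j)) *\<^sub>R u j)"
proof -
  have Tv: "T (v j) = a j *\<^sub>R u j" if "j < CARD('n)" for j
    using svd that by (simp add: svd_def)
  have "T x = T (\<Sum>j<CARD('n). (x \<bullet> v j) *\<^sub>R v j)"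
    using svd unfolding svd_def by metis
  also have "\<dots> = (\<Sum>j<CARD('n). (a j * (x \<bullet> v j)) *\<^sub>R u j)"
    by (simp add: linear_sum[OF T] linear_scale[OF T] Tv mult.commute)
  finally show ?thesis .
qed

text \<open>Lay a grid of mesh \<open>r\<close> along the axes \<open>u j\<close> and round
  coordinates down. Each coordinate is off by at most \<open>r\<close>, and the triangle inequality
  adds these errors up to the radius of the balls.\<close>

lemma ellipsoid_cover:
  fixes T :: "real ^ 'n \<Rightarrow> real ^ 'n"
  assumes T: "linear T" and svd: "svd T v u a" and r: "0 < r"
  obtains F where "finite F" "T ` cball 0 1 \<subseteq> (\<Union>y\<in>F. cball y (real CARD('n) * r))"
    "real (card F) \<le> 5 ^ CARD('n) * (\<Prod>j<CARD('n). max 1 (a j / r))"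
proof -
  define I where "I j = {- \<lceil>a j / r\<rceil>..\<lceil>a j / r\<rceil>}" for j
  define p where "p k = (\<Sum>j<CARD('n). (r * of_int (k j)) *\<^sub>R u j)" for k :: "nat \<Rightarrow> int"
  define F where "F = p ` (\<Pi>\<^sub>E j\<in>{..<CARD('n)}. I j)"
  note pos = svd_pos[OF svd]
  have fin: "finite (\<Pi>\<^sub>E j\<in>{..<CARD('n)}. I j)"
    by (intro finite_PiE) (auto simp: I_def)
  \<comment> \<open>The 5 arises from
    \<open>2 * \<lceil>x\<rceil> + 1 \<le> 2 * x + 3 \<le> 5 * max 1 x\<close>.\<close>
  have cardI: "real (card (I j)) \<le> 5 * max 1 (a j / r)" if "j < CARD('n)" for j
  proof -
    have "0 \<le> \<lceil>a j / r\<rceil>"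
      using pos[OF that] r by (simp add: order.strict_trans1[of _ 0])
    then have "real (card (I j)) = 2 * of_int \<lceil>a j / r\<rceil> + 1"
      by (simp add: I_def)
    also have "\<dots> \<le> 2 * (a j / r + 1) + 1"
      by (intro add_right_mono mult_left_mono of_int_ceiling_le_add_one) simp
    also have "\<dots> \<le> 5 * max 1 (a j / r)"
      by (simp add: max_def)
    finally show ?thesis .
  qed
  show thesis
  proof (rule that)
    show "finite F" using fin by (simp add: F_def)
    have "real (card F) \<le> real (card (\<Pi>\<^sub>E j\<in>{..<CARD('n)}. I j))"
      unfolding F_def using card_image_le[OF fin] by simp
    also have "\<dots> = (\<Prod>j<CARD('n). real (card (I j)))"
      by (simp add: card_PiE)
    also have "\<dots> \<le> (\<Prod>j<CARD('n). 5 * max 1 (a j / r))"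
      using cardI by (intro prod_mono) auto
    also have "\<dots> = 5 ^ CARD('n) * (\<Prod>j<CARD('n). max 1 (a j / r))"
      by (simp add: prod.distrib)
    finally show "real (card F) \<le> 5 ^ CARD('n) * (\<Prod>j<CARD('n). max 1 (a j / r))" .
    show "T ` cball 0 1 \<subseteq> (\<Union>y\<in>F. cball y (real CARD('n) * r))"
    proof clarify
      fix x :: "real ^ 'n" assume "x \<in> cball 0 1"
      then have x: "norm x \<le> 1" by simp
      define k where "k = restrict (\<lambda>j. \<lfloor>a j / r * (x \<bullet> v j)\<rfloor>) {..<CARD('n)}"
      have "k j \<in> I j" if j: "j < CARD('n)" for j
      proof -
        have "\<bar>x \<bullet> v j\<bar> \<le> 1"
          using Cauchy_Schwarz_ineq2[of x "v j"] svd_norm(1)[OF svd j] x by simp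
        moreover have "0 \<le> a j / r" using pos[OF j] r by simp
        ultimately have "\<bar>a j / r * (x \<bullet> v j)\<bar> \<le> a j / r"
          by (metis abs_mult abs_of_nonneg mult_left_le)
        then have "\<lfloor>a j / r * (x \<bullet> v j)\<rfloor> \<le> \<lceil>a j / r\<rceil>" "- \<lceil>a j / r\<rceil> \<le> \<lfloor>a j / r * (x \<bullet> v j)\<rfloor>"
          by linarith+
        then show ?thesis
          using j by (simp add: k_def I_def)
      qed
      moreover have "k j = undefined" if "j \<notin> {..<CARD('n)}" for j
        using that by (simp add: k_def)
      ultimately have kF: "p k \<in> F"
        unfolding F_def by (intro imageI PiE_I) auto
      have "p k - T x = (\<Sum>j<CARD('n). (r * of_int (k j) - a j * (x \<bullet> v j)) *\<^sub>R u j)"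
        unfolding p_def svd_apply[OF T svd] by (simp add: sum_subtractf scaleR_diff_left)
      also have "norm \<dots> \<le> (\<Sum>j<CARD('n). r)"
      proof (rule sum_norm_le)
        fix j assume "j \<in> {..<CARD('n)}"
        then have j: "j < CARD('n)" by simp
        have "r * of_int (k j) - a j * (x \<bullet> v j) =
          r * (of_int \<lfloor>a j / r * (x \<bullet> v j)\<rfloor> - a j / r * (x \<bullet> v j))"
          using r j by (simp add: k_def field_simps)
        also have "\<bar>\<dots>\<bar> = r * \<bar>of_int \<lfloor>a j / r * (x \<bullet> v j)\<rfloor> - a j / r * (x \<bullet> v j)\<bar>"
          using r by (simp add: abs_mult)
        also have "\<dots> \<le> r * 1"
          using r by (intro mult_left_mono) linarith+
        finally show "norm ((r * of_int (k j) - a j * (x \<bullet> v j)) *\<^sub>R u j) \<le> r"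
          using svd_norm(2)[OF svd j] by simp
      qed
      finally have "T x \<in> cball (p k) (real CARD('n) * r)"
        by (simp add: dist_norm)
      with kF show "T x \<in> (\<Union>y\<in>F. cball y (real CARD('n) * r))" by blast
    qed
  qed
qed

text \<open>Grid points at spacing \<open>3 * r\<close> lie in different balls of radius
  \<open>r\<close>, since two points of one ball are at most \<open>2 * r\<close> apart. Keeping
  every coordinate at most \<open>a j / N\<close> places the grid point inside the ellipsoid.
  Together this gives the factor \<open>3 * N\<close>.\<close>

lemma ellipsoid_packing:
  fixes T :: "real ^ 'n \<Rightarrow> real ^ 'n"
  assumes T: "linear T" and svd: "svd T v u a" and r: "0 < r"
    and F: "finite F" "T ` cball 0 1 \<subseteq> (\<Union>y\<in>F. cball y r)"
  shows "(\<Prod>j<CARD('n). max 1 (a j / (3 * real CARD('n) * r))) \<le> real (card F)"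
proof -
  define N where "N = real CARD('n)"
  define I where "I j = {0..nat \<lfloor>a j / (3 * N * r)\<rfloor>}" for j
  define p where "p k = (\<Sum>j<CARD('n). (3 * r * real (k j)) *\<^sub>R u j)" for k :: "nat \<Rightarrow> nat"
  define K where "K = (\<Pi>\<^sub>E j\<in>{..<CARD('n)}. I j)"
  note pos = svd_pos[OF svd]
  have N: "N > 0" by (simp add: N_def)
  have "finite K"
    unfolding K_def by (intro finite_PiE) (auto simp: I_def)
  have pT: "p k \<in> T ` cball 0 1" if "k \<in> K" for k
  proof
    define x where "x = (\<Sum>j<CARD('n). (3 * r * real (k j) / a j) *\<^sub>R v j)"
    have "T x = (\<Sum>j<CARD('n). (3 * r * real (k j) / a j) *\<^sub>R T (v j))"
      by (simp add: x_def linear_sum[OF T] linear_scale[OF T])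
    also have "\<dots> = p k"
      unfolding p_def
    proof (rule sum.cong)
      fix j assume "j \<in> {..<CARD('n)}"
      then have "T (v j) = a j *\<^sub>R u j" "a j > 0"
        using svd by (auto simp: svd_def)
      then show "(3 * r * real (k j) / a j) *\<^sub>R T (v j) = (3 * r * real (k j)) *\<^sub>R u j"
        by simp
    qed simp
    finally show "p k = T x" by simp
    have "norm x \<le> (\<Sum>j<CARD('n). 1 / N)"
      unfolding x_def
    proof (rule sum_norm_le)
      fix j assume "j \<in> {..<CARD('n)}"
      then have j: "j < CARD('n)" by simp
      have "k j \<in> I j" using that j by (auto simp: K_def)
      moreover have "0 \<le> a j / (3 * N * r)" using pos[OF j] r N by simp
      ultimately have "real (k j) \<le> a j / (3 * N * r)"
        by (simp add: I_def) linarith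
      then have "3 * r * real (k j) / a j \<le> 1 / N"
        using pos[OF j] r N by (simp add: field_simps)
      then show "norm ((3 * r * real (k j) / a j) *\<^sub>R v j) \<le> 1 / N"
        using svd_norm(1)[OF svd j] pos[OF j] r by simp
    qed
    then show "x \<in> cball 0 1"
      using N by (simp add: N_def)
  qed
  then have "\<forall>k\<in>K. \<exists>y\<in>F. p k \<in> cball y r"
    using F(2) by blast
  then obtain g where g: "\<And>k. k \<in> K \<Longrightarrow> g k \<in> F" "\<And>k. k \<in> K \<Longrightarrow> p k \<in> cball (g k) r"
    by metis
  have "inj_on g K"
  proof (rule inj_onI)
    fix k k' assume k: "k \<in> K" "k' \<in> K" and eq: "g k = g k'"
    have "dist (p k) (p k') \<le> 2 * r"
      using g(2)[OF k(1)] g(2)[OF k(2)] eq dist_triangle2[of "p k" "p k'" "g k"]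
      by (simp add: dist_commute)
    then have d: "norm (p k - p k') \<le> 2 * r" by (simp add: dist_norm)
    have "k j = k' j" if j: "j < CARD('n)" for j
    proof -
      have inner: "p k \<bullet> u j = 3 * r * real (k j)" for k
      proof -
        have "p k \<bullet> u j = (\<Sum>i<CARD('n). if i = j then 3 * r * real (k j) else 0)"
          unfolding p_def inner_sum_left using svd j by (intro sum.cong) (auto simp: svd_def)
        then show ?thesis using j by simp
      qed
      have "\<bar>(p k - p k') \<bullet> u j\<bar> \<le> 2 * r"
        using Cauchy_Schwarz_ineq2[of "p k - p k'" "u j"] svd_norm(2)[OF svd j] d by simp
      then have "\<bar>r * (3 * (real (k j) - real (k' j)))\<bar> \<le> r * 2"
        by (simp add: inner_diff_left inner algebra_simps)
      then have "\<bar>3 * (real (k j) - real (k' j))\<bar> \<le> 2"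
        using r by (simp only: abs_mult[of r] abs_of_pos mult_le_cancel_left_pos)
      then have "3 * (real (k j) - real (k' j)) \<le> 2" "- (3 * (real (k j) - real (k' j))) \<le> 2"
        by (simp_all only: abs_le_iff)
      then have "\<not> real (k j) + 1 \<le> real (k' j)" "\<not> real (k' j) + 1 \<le> real (k j)"
        by (simp_all add: not_le)
      then show ?thesis by simp
    qed
    then show "k = k'"
      using k by (intro PiE_ext[of k "{..<CARD('n)}" I]) (auto simp: K_def)
  qed
  then have "card K \<le> card F"
    using g(1) F(1) by (intro card_inj_on_le[of g]) auto
  have "(\<Prod>j<CARD('n). max 1 (a j / (3 * N * r))) \<le> (\<Prod>j<CARD('n). real (card (I j)))"
  proof (rule prod_mono)
    fix j assume "j \<in> {..<CARD('n)}"
    then have "0 \<le> a j / (3 * N * r)" using pos[of j] r N by simp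
    then show "0 \<le> max 1 (a j / (3 * N * r)) \<and> max 1 (a j / (3 * N * r)) \<le> real (card (I j))"
      by (simp add: I_def) linarith
  qed
  also have "\<dots> = real (card K)"
    by (simp add: K_def card_PiE)
  also have "\<dots> \<le> real (card F)"
    using \<open>card K \<le> card F\<close> by simp
  finally show ?thesis by (simp add: N_def)
qed

text \<open>As the exponents lie between 0 and 1, each factor \<open>(a j / d) powr w j\<close> is
  at most \<open>max 1 (a j / d)\<close>, whatever the radius. The packing bound, with
  \<open>d\<close> as its scale, controls the product of these maxima.\<close>

lemma sv_fun_le_covering:
  fixes T :: "real ^ 'n \<Rightarrow> real ^ 'n"
  assumes T: "linear T" "inj T" and r: "0 < r"
    and F: "finite F" "T ` cball 0 1 \<subseteq> (\<Union>y\<in>F. cball y r)" and s: "0 \<le> s" "s \<le> real CARD('n)"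
  shows "sv_fun s T \<le> (3 * real CARD('n) * r) powr s * real (card F)"
proof -
  obtain v u where svd: "svd T v u (\<lambda>j. singular_values T ! j)"
    using singular_values_svd T by blast
  define a where "a j = singular_values T ! j" for j
  define w where "w = sv_exponent CARD('n) s"
  define d where "d = 3 * real CARD('n) * r"
  have d: "0 < d" using r by (simp add: d_def)
  have a: "0 < a j" if "j < CARD('n)" for j
    using svd_pos[OF svd that] by (simp add: a_def)
  have w: "0 \<le> w j" "w j \<le> 1" for j
    using s by (simp_all add: w_def sv_exponent_nonneg sv_exponent_le_one)
  have "sv_fun s T = (\<Prod>j<CARD('n). d powr w j * (a j / d) powr w j)"
    unfolding sv_fun_eq_prod[OF svd s(1)] using a d
    by (intro prod.cong) (auto simp: a_def w_def less_imp_le simp flip: powr_mult)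
  also have "\<dots> = d powr s * (\<Prod>j<CARD('n). (a j / d) powr w j)"
    using d s by (simp add: prod.distrib w_def sum_sv_exponent flip: powr_sum)
  also have "(\<Prod>j<CARD('n). (a j / d) powr w j) \<le> (\<Prod>j<CARD('n). max 1 (a j / d))"
  proof (rule prod_mono)
    fix j assume "j \<in> {..<CARD('n)}"
    then have aj: "0 < a j / d" using a d by simp
    have "(a j / d) powr w j \<le> max 1 (a j / d) powr w j"
      using aj w by (intro powr_mono2) auto
    also have "\<dots> \<le> max 1 (a j / d) powr 1"
      using w by (intro powr_mono) auto
    finally show "0 \<le> (a j / d) powr w j \<and> (a j / d) powr w j \<le> max 1 (a j / d)"
      by simp
  qed
  also have "\<dots> \<le> real (card F)"
    using ellipsoid_packing[OF T(1) svd r F] by (simp add: a_def d_def)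
  finally show ?thesis
    by (simp add: d_def mult_left_mono)
qed

text \<open>At the last singular value with a positive exponent the comparison of
  \<open>(a j / r) powr w j\<close> with \<open>max 1 (a j / r)\<close> is an equality: earlier
  ratios are at least 1 with exponent 1, later ones at most 1 with exponent 0, and at
  \<open>r\<close> itself the ratio is 1.\<close>

lemma sv_fun_covering:
  fixes T :: "real ^ 'n \<Rightarrow> real ^ 'n"
  assumes T: "linear T" "inj T" and s: "0 < s" "s \<le> real CARD('n)"
  defines "r \<equiv> singular_values T ! (nat \<lceil>s\<rceil> - 1)"
  obtains F where "finite F" "T ` cball 0 1 \<subseteq> (\<Union>y\<in>F. cball y (real CARD('n) * r))"
    "real (card F) * r powr s \<le> 5 ^ CARD('n) * sv_fun s T"
proof -
  obtain v u where svd: "svd T v u (\<lambda>j. singular_values T ! j)"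
    using singular_values_svd T by blast
  define a where "a j = singular_values T ! j" for j
  define w where "w = sv_exponent CARD('n) s"
  obtain l where l: "nat \<lceil>s\<rceil> = Suc l"
    using s by (metis zero_less_ceiling zero_less_nat_eq gr0_conv_Suc)
  then have ls: "real l < s" "s \<le> real l + 1"
    by linarith+
  have lN: "l < CARD('n)"
    using ls s by linarith
  have r_eq: "r = a l" using l by (simp add: r_def a_def)
  have a: "0 < a j" if "j < CARD('n)" for j
    using svd_pos[OF svd that] by (simp add: a_def)
  have r: "0 < r" using a lN by (simp add: r_eq)
  obtain F where F: "finite F" "T ` cball 0 1 \<subseteq> (\<Union>y\<in>F. cball y (real CARD('n) * r))"
    "real (card F) \<le> 5 ^ CARD('n) * (\<Prod>j<CARD('n). max 1 (a j / r))"
    using ellipsoid_cover[OF T(1) svd r] by (auto simp: a_def)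
  have "(\<Prod>j<CARD('n). max 1 (a j / r)) = (\<Prod>j<CARD('n). (a j / r) powr w j)"
  proof (rule prod.cong)
    fix j assume "j \<in> {..<CARD('n)}"
    then have j: "j < CARD('n)" by simp
    have mono: "a j \<le> a i" if "i \<le> j" "j < CARD('n)" for i j
      using svd that by (simp add: svd_def a_def)
    consider "j < l" | "j = l" | "l < j" by linarith
    then show "max 1 (a j / r) = (a j / r) powr w j"
    proof cases
      case 1
      then have "real j + 1 \<le> real l" by linarith
      then have "w j = 1"
        using ls s by (simp add: w_def sv_exponent_def)
      then show ?thesis
        using mono[of j l] 1 lN r by (simp add: r_eq)
    next
      case 2
      then show ?thesis using r by (simp add: r_eq)
    next
      case 3
      then have "real l + 1 \<le> real j" by linarith
      then have "w j = 0"
        using ls s by (simp add: w_def sv_exponent_def)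
      then show ?thesis
        using mono[of l j] 3 j r a[OF j] by (simp add: r_eq)
    qed
  qed simp
  moreover have "sv_fun s T = r powr s * (\<Prod>j<CARD('n). (a j / r) powr w j)"
  proof -
    have "sv_fun s T = (\<Prod>j<CARD('n). r powr w j * (a j / r) powr w j)"
      unfolding sv_fun_eq_prod[OF svd less_imp_le[OF s(1)]] using a r
      by (intro prod.cong) (auto simp: a_def w_def less_imp_le simp flip: powr_mult)
    then show ?thesis
      using r s by (simp add: prod.distrib w_def sum_sv_exponent flip: powr_sum)
  qed
  ultimately have "real (card F) * r powr s \<le> 5 ^ CARD('n) * sv_fun s T"
    using mult_right_mono[OF F(3), of "r powr s"] by (simp add: mult.commute mult.left_commute)
  with that F show thesis by blast
qed

lemma linear_image_cball:
  fixes T :: "'a::real_normed_vector \<Rightarrow> 'b::real_normed_vector"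
  assumes "linear T" "0 < r" "T ` cball 0 1 \<subseteq> (\<Union>y\<in>F. cball y d)"
  shows "T ` cball x r \<subseteq> (\<Union>y\<in>F. cball (T x + r *\<^sub>R y) (r * d))"
proof clarify
  fix z assume "z \<in> cball x r"
  then have "(z - x) /\<^sub>R r \<in> cball 0 1"
    using assms(2) by (simp add: dist_norm norm_minus_commute divide_inverse_commute[symmetric])
  then obtain y where y: "y \<in> F" "T ((z - x) /\<^sub>R r) \<in> cball y d"
    using assms(3) by blast
  have "T z = T x + r *\<^sub>R T ((z - x) /\<^sub>R r)"
    using assms(2) by (simp add: linear_scale[OF assms(1)] linear_diff[OF assms(1)])
  then have "dist (T x + r *\<^sub>R y) (T z) = r * dist y (T ((z - x) /\<^sub>R r))"
    using assms(2) by (simp add: dist_norm flip: scaleR_diff_right)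
  with y assms(2) show "T z \<in> (\<Union>y\<in>F. cball (T x + r *\<^sub>R y) (r * d))"
    by (auto intro!: bexI[of _ y])
qed

text \<open>
  Up to constants \<open>\<phi>\<^sup>s(T)\<close> is \<open>r\<^sup>s\<close> times the number of \<open>r\<close>-balls needed to cover the ellipsoid
  \<open>T(B(0,1))\<close> for \<open>r = \<alpha>\<^sub>l(T)\<close>, and never larger than this product for other \<open>r\<close>.
  Submultiplicativity of covering numbers thus replaces exterior powers.
\<close>

lemma sv_fun_comp_small:
  fixes S T :: "real ^ 'n \<Rightarrow> real ^ 'n"
  assumes S: "linear S" "inj S" and T: "linear T" "inj T" and s: "0 < s" "s \<le> real CARD('n)"
  shows "sv_fun s (S \<circ> T) \<le> (3 * real CARD('n) ^ 3) powr s * 25 ^ CARD('n) * sv_fun s S * sv_fun s T"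
proof -
  define N where "N = real CARD('n)"
  define a where "a = singular_values S ! (nat \<lceil>s\<rceil> - 1)"
  define b where "b = singular_values T ! (nat \<lceil>s\<rceil> - 1)"
  have lN: "nat \<lceil>s\<rceil> - 1 < CARD('n)"
    using s by linarith
  obtain v u where "svd S v u (\<lambda>j. singular_values S ! j)"
    using singular_values_svd S by blast
  from svd_pos[OF this lN] have a: "a > 0" by (simp add: a_def)
  obtain v u where "svd T v u (\<lambda>j. singular_values T ! j)"
    using singular_values_svd T by blast
  from svd_pos[OF this lN] have b: "b > 0" by (simp add: b_def)
  have N: "N > 0" by (simp add: N_def)
  obtain F where F: "finite F" "S ` cball 0 1 \<subseteq> (\<Union>y\<in>F. cball y (N * a))"
    "real (card F) * a powr s \<le> 5 ^ CARD('n) * sv_fun s S"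
    using sv_fun_covering[OF S s] unfolding N_def a_def by metis
  obtain G where G: "finite G" "T ` cball 0 1 \<subseteq> (\<Union>y\<in>G. cball y (N * b))"
    "real (card G) * b powr s \<le> 5 ^ CARD('n) * sv_fun s T"
    using sv_fun_covering[OF T s] unfolding N_def b_def by metis
  \<comment> \<open>Each ball covering the image under \<open>T\<close> is mapped by
    \<open>S\<close> to a copy of the other ellipsoid scaled by \<open>N * b\<close>. The two covers
    and the packing bound contribute factors N, N and 3N to the radius, hence 3N^3; the two counts
    contribute 5^N each.\<close>
  define H where "H = (\<lambda>(x, y). S x + (N * b) *\<^sub>R y) ` (G \<times> F)"
  have H: "finite H" using F G by (simp add: H_def)
  have "(S \<circ> T) ` cball 0 1 \<subseteq> (\<Union>x\<in>G. S ` cball x (N * b))"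
    using G(2) by (force simp: image_comp[symmetric])
  also have "\<dots> \<subseteq> (\<Union>x\<in>G. \<Union>y\<in>F. cball (S x + (N * b) *\<^sub>R y) (N * b * (N * a)))"
    by (rule UN_mono[OF order_refl linear_image_cball[OF S(1) _ F(2)]]) (simp add: N b)
  also have "\<dots> = (\<Union>y\<in>H. cball y (N * b * (N * a)))"
    by (auto simp: H_def)
  finally have cover: "(S \<circ> T) ` cball 0 1 \<subseteq> (\<Union>y\<in>H. cball y (N * b * (N * a)))" .
  have "card H \<le> card G * card F"
    unfolding H_def card_cartesian_product[symmetric]
    using F G by (intro card_image_le) simp
  then have cardH: "real (card H) \<le> real (card F) * real (card G)"
    by (metis mult.commute of_nat_le_iff of_nat_mult)
  have "sv_fun s (S \<circ> T) \<le> (3 * real CARD('n) * (N * b * (N * a))) powr s * real (card H)"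
    using S T a b N s cover H
    by (intro sv_fun_le_covering) (auto intro: linear_compose inj_compose)
  also have "\<dots> = ((3 * N ^ 3) * a * b) powr s * real (card H)"
    by (simp add: N_def power3_eq_cube mult_ac)
  also have "\<dots> = (3 * N ^ 3) powr s * (a powr s * b powr s * real (card H))"
    using a b N by (simp add: powr_mult)
  also have "\<dots> \<le> (3 * N ^ 3) powr s * (a powr s * b powr s * (real (card F) * real (card G)))"
    using cardH by (intro mult_left_mono) auto
  also have "\<dots> = (3 * N ^ 3) powr s * ((real (card F) * a powr s) * (real (card G) * b powr s))"
    by (simp add: mult_ac)
  also have "\<dots> \<le> (3 * N ^ 3) powr s * ((5 ^ CARD('n) * sv_fun s S) * (5 ^ CARD('n) * sv_fun s T))"
    by (intro mult_left_mono mult_mono F(3) G(3))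
      (auto simp: less_imp_le[OF sv_fun_pos] S T s less_imp_le[OF s(1)])
  also have "\<dots> = (3 * N ^ 3) powr s * 25 ^ CARD('n) * sv_fun s S * sv_fun s T"
    by (simp add: mult_ac flip: power_mult_distrib)
  finally show ?thesis by (simp add: N_def)
qed

theorem sv_fun_comp:
  assumes "0 \<le> s"
  obtains C where "1 \<le> C"
    "\<And>S T :: real ^ 'n \<Rightarrow> real ^ 'n. linear S \<Longrightarrow> inj S \<Longrightarrow> linear T \<Longrightarrow> inj T \<Longrightarrow>
      sv_fun s (S \<circ> T) \<le> C * sv_fun s S * sv_fun s T"
proof -
  define N where "N = real CARD('n)"
  define D where "D s = (3 * N ^ 3) powr s * 25 ^ CARD('n)" for s
  have N1: "1 \<le> N" by (simp add: N_def Suc_leI)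
  have D1: "1 \<le> D s" if "0 \<le> s" for s
  proof -
    have "1 \<le> N ^ 3" using N1 by simp
    then have "1 \<le> (3 * N ^ 3) powr s" using that by (intro ge_one_powr_ge_zero) auto
    then show ?thesis unfolding D_def using mult_mono[of 1 "(3 * N ^ 3) powr s" 1 "25 ^ CARD('n)"] by simp
  qed
  consider "s = 0" | "0 < s" "s \<le> N" | "s > N"
    using assms by linarith
  then show thesis
  proof cases
    case 1
    then show thesis using that[of 1] by (simp add: sv_fun_def)
  next
    case 2
    show thesis
    proof (rule that)
      show "1 \<le> D s" using D1 assms .
      show "sv_fun s (S \<circ> T) \<le> D s * sv_fun s S * sv_fun s T"
        if "linear S" "inj S" "linear T" "inj T" for S T :: "real ^ 'n \<Rightarrow> real ^ 'n"
        using sv_fun_comp_small[OF that] 2 by (simp add: D_def N_def)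
    qed
  next
    case 3
    \<comment> \<open>Beyond N all exponents equal \<open>s / N\<close>, so phi^s is a power of
      phi^N and the preceding case carries over.\<close>
    have eq: "sv_fun s T = sv_fun N T powr (s / N)" if T: "linear T" "inj T" for T :: "real ^ 'n \<Rightarrow> real ^ 'n"
    proof -
      obtain v u where svd: "svd T v u (\<lambda>j. singular_values T ! j)"
        using singular_values_svd T by blast
      have one: "sv_exponent CARD('n) N j = 1" if "j < CARD('n)" for j
      proof -
        have "real j + 1 \<le> N" using that by (simp add: N_def)
        then show ?thesis by (simp add: sv_exponent_def N_def)
      qed
      have "sv_fun N T = (\<Prod>j<CARD('n). singular_values T ! j)"
        using svd_pos[OF svd] one N1 by (subst sv_fun_eq_prod[OF svd]) (auto intro!: prod.cong simp: less_imp_le)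
      moreover have "sv_fun s T = (\<Prod>j<CARD('n). (singular_values T ! j) powr (s / N))"
        using 3 N1 by (subst sv_fun_eq_prod[OF svd]) (auto simp: sv_exponent_def N_def)
      ultimately show ?thesis by (simp add: prod_powr_distrib)
    qed
    have sN: "0 \<le> s / N" using 3 N1 by simp
    show thesis
    proof (rule that)
      show "1 \<le> D N powr (s / N)"
        using D1[of N] N1 sN by (intro ge_one_powr_ge_zero) auto
      fix S T :: "real ^ 'n \<Rightarrow> real ^ 'n"
      assume S: "linear S" "inj S" and T: "linear T" "inj T"
      have ST: "linear (S \<circ> T)" "inj (S \<circ> T)"
        using S T by (auto intro: linear_compose inj_compose)
      have pos: "0 < sv_fun N S" "0 < sv_fun N T" "0 < sv_fun N (S \<circ> T)"
        using S T ST N1 by (auto intro!: sv_fun_pos)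
      have "sv_fun N (S \<circ> T) \<le> D N * sv_fun N S * sv_fun N T"
        using sv_fun_comp_small[OF S T, of N] N1 by (simp add: D_def N_def)
      then have "sv_fun N (S \<circ> T) powr (s / N) \<le> (D N * sv_fun N S * sv_fun N T) powr (s / N)"
        using pos sN by (intro powr_mono2) auto
      also have "\<dots> = D N powr (s / N) * sv_fun N S powr (s / N) * sv_fun N T powr (s / N)"
        using pos D1[of N] N1 by (simp add: powr_mult)
      finally show "sv_fun s (S \<circ> T) \<le> D N powr (s / N) * sv_fun s S * sv_fun s T"
        using eq[OF S] eq[OF T] eq[OF ST] by simp
    qed
  qed
qed

section \<open>Minimax comparison of the singular values of a composition\<close>

lemma svd_norm_sq:
  fixes T :: "real ^ 'n \<Rightarrow> real ^ 'n"
  assumes T: "linear T" and svd: "svd T v u a"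
  shows "(norm x)\<^sup>2 = (\<Sum>i<CARD('n). (x \<bullet> v i)\<^sup>2)"
    "(norm (T x))\<^sup>2 = (\<Sum>i<CARD('n). (a i * (x \<bullet> v i))\<^sup>2)"
proof -
  have pyth: "(norm (\<Sum>i<CARD('n). c i *\<^sub>R e i))\<^sup>2 = (\<Sum>i<CARD('n). (c i)\<^sup>2)"
    if e: "\<forall>i<CARD('n). \<forall>j<CARD('n). e i \<bullet> e j = (if i = j then 1 else 0)"
    for c and e :: "nat \<Rightarrow> real ^ 'n"
  proof -
    have "(norm (\<Sum>i<CARD('n). c i *\<^sub>R e i))\<^sup>2 =
      (\<Sum>i<CARD('n). \<Sum>j<CARD('n). (c i * c j) * (e j \<bullet> e i))"
      by (simp add: power2_norm_eq_inner inner_sum_left inner_sum_right sum_distrib_left mult_ac)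
    also have "\<dots> = (\<Sum>i<CARD('n). \<Sum>j<CARD('n). if i = j then (c i)\<^sup>2 else 0)"
      using e by (intro sum.cong) (auto simp: power2_eq_square)
    finally show ?thesis by simp
  qed
  have "x = (\<Sum>i<CARD('n). (x \<bullet> v i) *\<^sub>R v i)"
    using svd unfolding svd_def by metis
  then show "(norm x)\<^sup>2 = (\<Sum>i<CARD('n). (x \<bullet> v i)\<^sup>2)"
    using pyth[of v "\<lambda>i. x \<bullet> v i"] svd by (simp add: svd_def)
  show "(norm (T x))\<^sup>2 = (\<Sum>i<CARD('n). (a i * (x \<bullet> v i))\<^sup>2)"
    unfolding svd_apply[OF T svd] using svd unfolding svd_def by (intro pyth) blast
qed

text \<open>
  The two spaces of test vectors used for the minimax principle, one for \<open>S\<close> and one for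
  \<open>S \<circ> T\<close>, are cut out by fewer than \<open>CARD('n)\<close> linear equations.
\<close>

lemma singular_value_comp_ge:
  fixes S T :: "real ^ 'n \<Rightarrow> real ^ 'n"
  assumes S: "linear S" "inj S" and T: "linear T" "inj T"
    and c: "0 \<le> c" "\<And>x. c * norm x \<le> norm (T x)" and j: "j < CARD('n)"
  shows "c * (singular_values S ! j) \<le> singular_values (S \<circ> T) ! j"
proof -
  have ST: "linear (S \<circ> T)" "inj (S \<circ> T)"
    using S T by (auto intro: linear_compose inj_compose)
  define a where "a i = singular_values S ! i" for i
  define b where "b i = singular_values (S \<circ> T) ! i" for i
  obtain v u where S': "svd S v u a"
    using singular_values_svd[OF S] by (auto simp: a_def[abs_def])
  obtain v' u' where ST': "svd (S \<circ> T) v' u' b"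
    using singular_values_svd[OF ST] by (auto simp: b_def[abs_def])
  \<comment> \<open>The first family, moved to \<open>x\<close> by the adjoint, puts
    \<open>T x\<close> where \<open>S\<close> stretches by at least \<open>a j\<close>; the second
    puts \<open>x\<close> where \<open>S \<circ> T\<close> stretches by at most
    \<open>b j\<close>.\<close>
  define X where "X = (\<lambda>i. adjoint T (v i)) ` {j<..<CARD('n)} \<union> v' ` {..<j}"
  have "card X \<le> card {j<..<CARD('n)} + card {..<j}"
    unfolding X_def by (meson add_mono card_Un_le card_image_le finite_greaterThanLessThan
        finite_lessThan order_trans)
  also have "\<dots> < CARD('n)" using j by simp
  finally have cardX: "card X < CARD('n)" .
  have "finite X" by (simp add: X_def)
  then have "dim (span X) < CARD('n)"
    using dim_le_card'[of X] cardX by simp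
  then have "span X \<noteq> UNIV"
    using dim_UNIV[where 'a = "real ^ 'n"] by (metis DIM_cart DIM_real less_irrefl mult.right_neutral)
  then obtain x where x: "x \<noteq> 0" "\<forall>y\<in>span X. x \<bullet> y = 0"
    using span_not_UNIV_orthogonal by blast
  then have orth: "x \<bullet> y = 0" if "y \<in> X" for y
    using that span_base by blast
  have x1: "T x \<bullet> v i = 0" if "j < i" "i < CARD('n)" for i
    using orth[of "adjoint T (v i)"] that adjoint_works[OF T(1)] by (auto simp: X_def)
  have x2: "x \<bullet> v' i = 0" if "i < j" for i
    using orth[of "v' i"] that by (auto simp: X_def)
  have pos: "0 < a i" "0 < b i" if "i < CARD('n)" for i
    using svd_pos[OF S' that] svd_pos[OF ST' that] by auto
  have "(a j * norm (T x))\<^sup>2 \<le> (norm (S (T x)))\<^sup>2"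
    unfolding power_mult_distrib svd_norm_sq[OF S(1) S', of "T x"] sum_distrib_left
  proof (rule sum_mono)
    fix i assume i: "i \<in> {..<CARD('n)}"
    show "(a j)\<^sup>2 * (T x \<bullet> v i)\<^sup>2 \<le> (a i)\<^sup>2 * (T x \<bullet> v i)\<^sup>2"
    proof (cases "i \<le> j")
      case True
      then have "a j \<le> a i" using S' j by (simp add: svd_def)
      then show ?thesis using pos[of j] j by (intro mult_right_mono power_mono) auto
    qed (use x1[of i] i in auto)
  qed
  then have le1: "a j * norm (T x) \<le> norm (S (T x))"
    by (rule power2_le_imp_le) simp
  have "(norm ((S \<circ> T) x))\<^sup>2 \<le> (b j * norm x)\<^sup>2"
    unfolding power_mult_distrib svd_norm_sq[OF ST(1) ST', of x] sum_distrib_left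
  proof (rule sum_mono)
    fix i assume i: "i \<in> {..<CARD('n)}"
    show "(b i)\<^sup>2 * (x \<bullet> v' i)\<^sup>2 \<le> (b j)\<^sup>2 * (x \<bullet> v' i)\<^sup>2"
    proof (cases "j \<le> i")
      case True
      then have "b i \<le> b j" using ST' i by (simp add: svd_def)
      then show ?thesis using pos[of i] i by (intro mult_right_mono power_mono) auto
    qed (use x2[of i] i in auto)
  qed
  then have le2: "norm (S (T x)) \<le> b j * norm x"
    using pos[OF j] power2_le_imp_le[of "norm ((S \<circ> T) x)" "b j * norm x"] by simp
  have "(c * a j) * norm x \<le> a j * norm (T x)"
    using c(2)[of x] pos[OF j] by (simp add: mult.commute mult.left_commute)
  also have "\<dots> \<le> b j * norm x" using le1 le2 by linarith
  finally have "c * a j \<le> b j" using x(1) by simp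
  then show ?thesis by (simp add: a_def b_def)
qed


subsection \<open>Words and cylinders\<close>

lemma words_lists: "w \<in> words m k \<Longrightarrow> w \<in> lists {1..m}"
  by (simp add: words_def)

lemma words_0 [simp]: "words m 0 = {[]}"
  by (auto simp: words_def)

lemma finite_words: "finite (words m k)"
  using finite_lists_length_eq[of "{1..m}" k] by (simp add: words_def lists_eq_set)

lemma sum_words_add:
  "(\<Sum>w\<in>words m (k + l). g w) = (\<Sum>u\<in>words m k. \<Sum>w\<in>words m l. g (u @ w))"
proof -
  have "(\<Sum>u\<in>words m k. \<Sum>w\<in>words m l. g (u @ w)) = (\<Sum>(u, w)\<in>words m k \<times> words m l. g (u @ w))"
    by (rule sum.cartesian_product)
  also have "\<dots> = (\<Sum>w\<in>words m (k + l). g w)"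
    by (rule sum.reindex_bij_witness[of _ "\<lambda>w. (take k w, drop k w)" "\<lambda>(u, w). u @ w"])
      (auto simp: words_def in_lists_conv_set dest: in_set_takeD in_set_dropD)
  finally show ?thesis ..
qed

lemma length_initial_seg [simp]: "length (initial_seg i k) = k"
  by (simp add: initial_seg_def)

lemma initial_seg_0 [simp]: "initial_seg i 0 = []"
  by (simp add: initial_seg_def)

lemma initial_seg_Suc: "initial_seg i (Suc k) = initial_seg i k @ [i k]"
  by (simp add: initial_seg_def)

lemma initial_seg_words: "i \<in> code_space m \<Longrightarrow> initial_seg i k \<in> words m k"
  by (auto simp: initial_seg_def words_def code_space_def)

lemma take_initial_seg: "k \<le> l \<Longrightarrow> take k (initial_seg i l) = initial_seg i k"
  by (simp add: initial_seg_def take_map)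

lemma funpow_code_shift: "(code_shift ^^ k) i = (\<lambda>j. i (k + j))"
  by (induction k arbitrary: i) (auto simp: code_shift_def)

lemma funpow_code_shift_space: "i \<in> code_space m \<Longrightarrow> (code_shift ^^ k) i \<in> code_space m"
  by (simp add: funpow_code_shift code_space_def)

lemma initial_seg_add: "initial_seg i (k + l) = initial_seg i k @ initial_seg ((code_shift ^^ k) i) l"
  by (induction l) (simp_all add: initial_seg_Suc funpow_code_shift)

lemma cylinder_nonempty:
  assumes "1 \<le> m" "w \<in> lists {1..m}"
  obtains i where "i \<in> code_space m" "initial_seg i (length w) = w"
proof
  define i where "i k = (if k < length w then w ! k else 1)" for k
  show "i \<in> code_space m"
    using assms by (auto simp: i_def code_space_def in_lists_conv_set)
  show "initial_seg i (length w) = w"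
    by (auto simp: i_def initial_seg_def intro: nth_equalityI)
qed

lemma cylinder_Nil [simp]: "cylinder m [] = code_space m"
  by (auto simp: cylinder_def)

lemma cylinder_snoc: "cylinder m w = (\<Union>j\<in>{1..m}. cylinder m (w @ [j]))"
  by (auto simp: cylinder_def initial_seg_Suc code_space_def)

lemma code_space_eq_cylinders: "code_space m = (\<Union>w\<in>words m k. cylinder m w)"
  using initial_seg_words by (fastforce simp: cylinder_def words_def)

lemma openin_cylinder: "openin (code_topology m) (cylinder m w)"
proof -
  interpret Metric_space "code_space m" code_dist
    by (rule Metric_space_code)
  show ?thesis
    unfolding code_topology_def openin_mtopology
  proof (intro conjI ballI allI impI)
    show "cylinder m w \<subseteq> code_space m" by (auto simp: cylinder_def)
    fix i assume i: "i \<in> cylinder m w"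
    have "j \<in> cylinder m w" if "j \<in> mball i ((1/2) ^ length w)" for j
    proof -
      have j: "j \<in> code_space m" "\<forall>k\<le>length w. i k = j k"
        using that by (auto simp: code_dist_less_iff)
      then have "initial_seg j (length w) = initial_seg i (length w)"
        by (simp add: initial_seg_def)
      then show ?thesis using i j(1) by (simp add: cylinder_def)
    qed
    then show "\<exists>r>0. mball i r \<subseteq> cylinder m w"
      by (intro exI[of _ "(1/2) ^ length w"]) auto
  qed
qed

lemma word_map_Nil [simp]: "word_map T [] = id"
  by (simp add: word_map_def)

lemma word_map_single [simp]: "word_map T [i] = T i"
  by (simp add: word_map_def)

lemma word_map_append: "word_map T (u @ w) = word_map T u \<circ> word_map T w"
  by (induction u) (simp_all add: word_map_def comp_assoc)

lemma word_map_Cons: "word_map T (i # w) = T i \<circ> word_map T w"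
  by (simp add: word_map_def)

subsection \<open>Gibbs measures are quasi-Bernoulli\<close>

locale gibbs_system =
  fixes m :: nat and T :: "nat \<Rightarrow> real ^ 'n \<Rightarrow> real ^ 'n" and \<mu> :: "(nat \<Rightarrow> nat) measure"
  assumes m: "2 \<le> m"
    and contr: "\<And>i. i \<in> {1..m} \<Longrightarrow> linear_contraction (T i) \<and> bij (T i)"
    and gibbs: "gibbs_measure m \<mu>"
begin

sublocale prob_space \<mu>
  using gibbs by (simp add: gibbs_measure_def)

lemma space_\<mu>: "space \<mu> = code_space m"
  using gibbs by (simp add: gibbs_measure_def)

lemma sets_cylinder [measurable, simp]: "cylinder m w \<in> sets \<mu>"
proof -
  have "sets \<mu> = sigma_sets (code_space m) {U. openin (code_topology m) U}"
    using gibbs by (simp add: gibbs_measure_def)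
  then show ?thesis
    using openin_cylinder by (auto intro: sigma_sets.Basic)
qed

text \<open>The weight \<open>G i k\<close> is the exponential of \<open>- k * P\<close> plus the
  Birkhoff sum of \<open>f\<close>. The cylinder measures are comparable to it, and it is exactly
  multiplicative along the shift.\<close>

lemma gibbs_bounds:
  obtains G :: "(nat \<Rightarrow> nat) \<Rightarrow> nat \<Rightarrow> real" and a :: real where "0 < a" "\<And>i k. 0 < G i k"
    "\<And>i k l. G i (k + l) = G i k * G ((code_shift ^^ k) i) l"
    "\<And>i k. i \<in> code_space m \<Longrightarrow> 1 \<le> k \<Longrightarrow> G i k \<le> a * prob (cylinder m (initial_seg i k))"
    "\<And>i k. i \<in> code_space m \<Longrightarrow> 1 \<le> k \<Longrightarrow> prob (cylinder m (initial_seg i k)) \<le> a * G i k"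
proof -
  obtain f P a where "a > 0" and ratio: "\<And>i k. i \<in> code_space m \<Longrightarrow> 1 \<le> k \<Longrightarrow>
      (let r = prob (cylinder m (initial_seg i k)) /
                   exp (- real k * P + (\<Sum>j<k. f ((code_shift ^^ j) i)))
           in inverse a \<le> r \<and> r \<le> a)"
    using gibbs unfolding gibbs_measure_def by blast
  define G where "G i k = exp (- real k * P + (\<Sum>j<k. f ((code_shift ^^ j) i)))" for i k
  have Gpos: "0 < G i k" for i k by (simp add: G_def)
  show thesis
  proof (rule that[OF \<open>a > 0\<close> Gpos])
    fix i k l
    have "(\<Sum>j<k + l. f ((code_shift ^^ j) i)) =
      (\<Sum>j<k. f ((code_shift ^^ j) i)) + (\<Sum>j<l. f ((code_shift ^^ j) ((code_shift ^^ k) i)))"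
      by (induction l) (simp_all add: funpow_code_shift add.assoc)
    then show "G i (k + l) = G i k * G ((code_shift ^^ k) i) l"
      by (simp add: G_def algebra_simps flip: exp_add)
  next
    fix i k assume "i \<in> code_space m" "(1::nat) \<le> k"
    from ratio[OF this] have "inverse a \<le> prob (cylinder m (initial_seg i k)) / G i k"
      "prob (cylinder m (initial_seg i k)) / G i k \<le> a"
      by (simp_all add: G_def Let_def)
    then show "G i k \<le> a * prob (cylinder m (initial_seg i k))"
      "prob (cylinder m (initial_seg i k)) \<le> a * G i k"
      using Gpos[of i k] \<open>a > 0\<close> by (simp_all add: field_simps)
  qed
qed

lemma prob_cylinder_pos:
  assumes w: "w \<in> lists {1..m}"
  shows "0 < prob (cylinder m w)"
proof (cases "w = []")
  case True
  then show ?thesis using prob_space by (simp flip: space_\<mu>)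
next
  case False
  obtain i where i: "i \<in> code_space m" "initial_seg i (length w) = w"
    using cylinder_nonempty[of m w] m w by auto
  obtain G :: "(nat \<Rightarrow> nat) \<Rightarrow> nat \<Rightarrow> real" and a where G: "0 < a" "\<And>i k. 0 < G i k"
    "\<And>i k. i \<in> code_space m \<Longrightarrow> 1 \<le> k \<Longrightarrow> G i k \<le> a * prob (cylinder m (initial_seg i k))"
    using gibbs_bounds by metis
  have "1 \<le> length w" using False by (simp add: Suc_le_eq)
  with G(3)[OF i(1)] G(2)[of i "length w"] i(2) have "0 < a * prob (cylinder m w)"
    by (metis less_le_trans)
  then show ?thesis using G(1) by (simp add: zero_less_mult_iff)
qed

text \<open>Compare all three cylinders with the multiplicative weight \<open>G\<close>; each
  comparison costs one factor \<open>a\<close>, hence \<open>a ^ 3\<close>. The Gibbs bounds start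
  at length 1, so empty words are treated apart, with \<open>K \<ge> 1\<close>.\<close>

lemma quasi_bernoulli:
  obtains K where "1 \<le> K"
    "\<And>u w. u \<in> lists {1..m} \<Longrightarrow> w \<in> lists {1..m} \<Longrightarrow>
      prob (cylinder m (u @ w)) \<le> K * prob (cylinder m u) * prob (cylinder m w)"
    "\<And>u w. u \<in> lists {1..m} \<Longrightarrow> w \<in> lists {1..m} \<Longrightarrow>
      prob (cylinder m u) * prob (cylinder m w) \<le> K * prob (cylinder m (u @ w))"
proof -
  obtain G :: "(nat \<Rightarrow> nat) \<Rightarrow> nat \<Rightarrow> real" and a where a: "0 < a" and Gpos: "\<And>i k. 0 < G i k"
    and Gadd: "\<And>i k l. G i (k + l) = G i k * G ((code_shift ^^ k) i) l"
    and lo: "\<And>i k. i \<in> code_space m \<Longrightarrow> 1 \<le> k \<Longrightarrow> G i k \<le> a * prob (cylinder m (initial_seg i k))"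
    and up: "\<And>i k. i \<in> code_space m \<Longrightarrow> 1 \<le> k \<Longrightarrow> prob (cylinder m (initial_seg i k)) \<le> a * G i k"
    using gibbs_bounds by metis
  define K where "K = max 1 (a ^ 3)"
  have one: "prob (cylinder m []) = 1"
    using prob_space by (simp flip: space_\<mu>)
  have main: "prob (cylinder m (u @ w)) \<le> K * prob (cylinder m u) * prob (cylinder m w) \<and>
      prob (cylinder m u) * prob (cylinder m w) \<le> K * prob (cylinder m (u @ w))"
    if u: "u \<in> lists {1..m}" and w: "w \<in> lists {1..m}" for u w
  proof (cases "u = [] \<or> w = []")
    case True
    have "p \<le> K * p" if "0 \<le> p" for p
      using mult_right_mono[of 1 K p] that by (simp add: K_def)
    then show ?thesis using True one by (auto simp: cylinder_Nil[symmetric] simp del: cylinder_Nil)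
  next
    case False
    define k l where "k = length u" and "l = length w"
    have kl: "1 \<le> k" "1 \<le> l" using False by (auto simp: k_def l_def Suc_le_eq)
    obtain i where i: "i \<in> code_space m" "initial_seg i (k + l) = u @ w"
      using cylinder_nonempty[of m "u @ w"] m u w by (auto simp: k_def l_def)
    define i' where "i' = (code_shift ^^ k) i"
    have i': "i' \<in> code_space m"
      using i(1) by (simp add: i'_def funpow_code_shift_space)
    have seg: "initial_seg i k = u" "initial_seg i' l = w"
      using i(2) by (auto simp: initial_seg_add i'_def k_def)
    let ?U = "prob (cylinder m u)" and ?W = "prob (cylinder m w)" and ?UW = "prob (cylinder m (u @ w))"
    have b: "G i k \<le> a * ?U" "?U \<le> a * G i k" "G i' l \<le> a * ?W" "?W \<le> a * G i' l"
      "G i k * G i' l \<le> a * ?UW" "?UW \<le> a * (G i k * G i' l)"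
      using lo[OF i(1) kl(1)] up[OF i(1) kl(1)] lo[OF i' kl(2)] up[OF i' kl(2)]
        lo[OF i(1), of "k + l"] up[OF i(1), of "k + l"] kl i(2) seg
      by (auto simp: Gadd i'_def)
    have "?UW \<le> a * ((a * ?U) * (a * ?W))"
      using b(6) mult_mono[OF b(1,3)] a Gpos[of i' l] by (smt (verit) measure_nonneg mult_left_mono mult_nonneg_nonneg)
    also have "\<dots> = a ^ 3 * (?U * ?W)" by (simp add: power3_eq_cube mult_ac)
    also have "\<dots> \<le> K * (?U * ?W)" by (intro mult_right_mono) (auto simp: K_def)
    finally have 1: "?UW \<le> K * ?U * ?W" by (simp add: mult_ac)
    have "?U * ?W \<le> (a * G i k) * (a * G i' l)"
      using a Gpos[of i k] by (intro mult_mono b) auto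
    also have "\<dots> = a * a * (G i k * G i' l)" by (simp add: mult_ac)
    also have "\<dots> \<le> a * a * (a * ?UW)" using a by (intro mult_left_mono b) auto
    also have "\<dots> = a ^ 3 * ?UW" by (simp add: power3_eq_cube mult_ac)
    also have "\<dots> \<le> K * ?UW" by (intro mult_right_mono) (auto simp: K_def)
    finally show ?thesis using 1 by simp
  qed
  show thesis
    by (rule that[of K]) (use main in \<open>auto simp: K_def\<close>)
qed

lemma sum_prob_cylinder_snoc: "(\<Sum>j\<in>{1..m}. prob (cylinder m (w @ [j]))) = prob (cylinder m w)"
proof -
  have "disjoint_family_on (\<lambda>j. cylinder m (w @ [j])) {1..m}"
    by (auto simp: disjoint_family_on_def cylinder_def initial_seg_Suc)
  then show ?thesis
    unfolding cylinder_snoc[of m w] by (intro finite_measure_finite_Union[symmetric]) auto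
qed

lemma sum_prob_cylinder: "(\<Sum>w\<in>words m k. prob (cylinder m w)) = 1"
proof -
  have "disjoint_family_on (cylinder m) (words m k)"
    by (auto simp: disjoint_family_on_def cylinder_def words_def)
  then have "(\<Sum>w\<in>words m k. prob (cylinder m w)) = prob (code_space m)"
    unfolding code_space_eq_cylinders[of m k]
    by (intro finite_measure_finite_Union[symmetric]) (auto simp: finite_words)
  then show ?thesis using prob_space by (simp flip: space_\<mu>)
qed

text \<open>As \<open>m \<ge> 2\<close>, every letter \<open>j\<close> has a sibling
  \<open>j'\<close>, and by the lower quasi-Bernoulli estimate the cylinder of the sibling keeps at
  least the fraction \<open>p / K\<close> of the parent. The 1/2 in \<open>\<theta>\<close> keeps it
  positive.\<close>

lemma prob_cylinder_decay:
  obtains \<theta> where "0 < \<theta>" "\<theta> < 1" "\<And>w. w \<in> lists {1..m} \<Longrightarrow> prob (cylinder m w) \<le> \<theta> ^ length w"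
proof -
  obtain K where K: "1 \<le> K" "\<And>u w. u \<in> lists {1..m} \<Longrightarrow> w \<in> lists {1..m} \<Longrightarrow>
      prob (cylinder m u) * prob (cylinder m w) \<le> K * prob (cylinder m (u @ w))"
    using quasi_bernoulli by metis
  define p where "p = Min ((\<lambda>j. prob (cylinder m [j])) ` {1..m})"
  have ne: "(\<lambda>j. prob (cylinder m [j])) ` {1..m} \<noteq> {}" using m by simp
  have "p \<in> (\<lambda>j. prob (cylinder m [j])) ` {1..m}"
    unfolding p_def using ne by (intro Min_in) auto
  then have p: "0 < p" using prob_cylinder_pos by auto
  have p_le: "p \<le> prob (cylinder m [j])" if "j \<in> {1..m}" for j
    unfolding p_def using that by (intro Min_le) auto
  define \<theta> where "\<theta> = max (1/2) (1 - p / K)"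
  have step: "prob (cylinder m (u @ [j])) \<le> \<theta> * prob (cylinder m u)"
    if u: "u \<in> lists {1..m}" and j: "j \<in> {1..m}" for u j
  proof -
    obtain j' where j': "j' \<in> {1..m}" "j' \<noteq> j"
      using m by (cases "j = 1") (auto intro: that[of 1] that[of 2])
    have "(\<Sum>i\<in>{j, j'}. prob (cylinder m (u @ [i]))) \<le> (\<Sum>i\<in>{1..m}. prob (cylinder m (u @ [i])))"
      using j j' by (intro sum_mono2) auto
    then have "prob (cylinder m (u @ [j])) + prob (cylinder m (u @ [j'])) \<le> prob (cylinder m u)"
      unfolding sum_prob_cylinder_snoc using j' by simp
    moreover have "p / K * prob (cylinder m u) \<le> prob (cylinder m (u @ [j']))"
    proof -
      have "p * prob (cylinder m u) \<le> prob (cylinder m [j']) * prob (cylinder m u)"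
        using p_le[OF j'(1)] by (intro mult_right_mono) auto
      also have "\<dots> \<le> K * prob (cylinder m (u @ [j']))"
        using K(2)[OF u, of "[j']"] j' by (simp add: mult.commute)
      finally show ?thesis using K(1) by (simp add: field_simps)
    qed
    ultimately have "prob (cylinder m (u @ [j])) \<le> (1 - p / K) * prob (cylinder m u)"
      by (simp add: algebra_simps)
    also have "\<dots> \<le> \<theta> * prob (cylinder m u)"
      by (intro mult_right_mono) (auto simp: \<theta>_def)
    finally show ?thesis .
  qed
  have \<theta>: "0 < \<theta>" "\<theta> < 1" using p K(1) by (auto simp: \<theta>_def)
  have "prob (cylinder m w) \<le> \<theta> ^ length w" if "w \<in> lists {1..m}" for w
    using that
  proof (induction w rule: rev_induct)
    case Nil
    then show ?case by simp
  next
    case (snoc j u)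
    have "prob (cylinder m (u @ [j])) \<le> \<theta> * prob (cylinder m u)"
      using snoc.prems by (intro step) auto
    also have "\<dots> \<le> \<theta> * \<theta> ^ length u"
      using snoc \<theta> by (intro mult_left_mono) auto
    finally show ?case by simp
  qed
  with that \<theta> show thesis by blast
qed

lemma contraction_constants:
  obtains b c where "0 < c" "c < 1" "0 < b" "b < 1"
    "\<And>i x. i \<in> {1..m} \<Longrightarrow> c * norm x \<le> norm (T i x)"
    "\<And>i x. i \<in> {1..m} \<Longrightarrow> norm (T i x) \<le> b * norm x"
proof -
  have lin: "linear (T i)" "inj (T i)" "onorm (T i) < 1" if "i \<in> {1..m}" for i
    using contr[OF that] by (auto simp: linear_contraction_def bij_is_inj)
  have "\<exists>c>0. \<forall>x. c * norm x \<le> norm (T i x)" if "i \<in> {1..m}" for i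
    using linear_inj_bounded_below_pos[OF lin(1,2)[OF that]] by metis
  then obtain C where C: "\<And>i. i \<in> {1..m} \<Longrightarrow> 0 < C i" "\<And>i x. i \<in> {1..m} \<Longrightarrow> C i * norm x \<le> norm (T i x)"
    by metis
  \<comment> \<open>Inserting 1/2 guarantees \<open>c < 1\<close> here and \<open>0 < b\<close> in
    the next line.\<close>
  define c where "c = Min (insert (1/2) (C ` {1..m}))"
  define b where "b = Max (insert (1/2) ((\<lambda>i. onorm (T i)) ` {1..m}))"
  have c_half: "c \<le> 1/2"
    unfolding c_def by (rule Min_le) auto
  have c: "0 < c" "\<And>i. i \<in> {1..m} \<Longrightarrow> c \<le> C i"
    unfolding c_def using C(1) by (auto simp: Min_gr_iff simp del: Min_insert intro!: Min_le)
  have b_half: "1/2 \<le> b"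
    unfolding b_def by (rule Max_ge) auto
  have b: "b < 1" "\<And>i. i \<in> {1..m} \<Longrightarrow> onorm (T i) \<le> b"
    unfolding b_def using lin(3) by (auto simp: Max_less_iff simp del: Max_insert intro!: Max_ge)
  show thesis
  proof (rule that)
    show "0 < c" "c < 1" "0 < b" "b < 1" using c c_half b b_half by auto
    fix i and x :: "real ^ 'n" assume i: "i \<in> {1..m}"
    have "c * norm x \<le> C i * norm x" using c(2)[OF i] by (intro mult_right_mono) auto
    then show "c * norm x \<le> norm (T i x)" using C(2)[OF i, of x] by linarith
    have "norm (T i x) \<le> onorm (T i) * norm x"
      using lin(1)[OF i] by (intro onorm) (simp add: linear_conv_bounded_linear)
    also have "\<dots> \<le> b * norm x" using b(2)[OF i] by (intro mult_right_mono) auto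
    finally show "norm (T i x) \<le> b * norm x" .
  qed
qed

lemma word_map_linear: "w \<in> lists {1..m} \<Longrightarrow> linear (word_map T w) \<and> inj (word_map T w)"
proof (induction w)
  case Nil
  then show ?case by (simp add: linear_id[unfolded id_def] id_def)
next
  case (Cons i w)
  then have "linear (T i)" "inj (T i)"
    using contr[of i] by (auto simp: linear_contraction_def bij_is_inj)
  with Cons show ?case
    by (auto simp: word_map_Cons linear_compose inj_compose simp del: o_apply)
qed

lemma word_map_bounds:
  assumes "0 < c" "0 < b" "\<And>i x. i \<in> {1..m} \<Longrightarrow> c * norm x \<le> norm (T i x)"
    "\<And>i x. i \<in> {1..m} \<Longrightarrow> norm (T i x) \<le> b * norm x" and w: "w \<in> lists {1..m}"
  shows "c ^ length w * norm x \<le> norm (word_map T w x)" "norm (word_map T w x) \<le> b ^ length w * norm x"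
proof -
  have "c ^ length w * norm x \<le> norm (word_map T w x) \<and> norm (word_map T w x) \<le> b ^ length w * norm x"
    using w
  proof (induction w)
    case (Cons i w)
    then have i: "i \<in> {1..m}" and IH: "c ^ length w * norm x \<le> norm (word_map T w x)"
      "norm (word_map T w x) \<le> b ^ length w * norm x" by auto
    have "c * (c ^ length w * norm x) \<le> c * norm (word_map T w x)"
      using IH(1) assms(1) by (intro mult_left_mono) auto
    also have "\<dots> \<le> norm (T i (word_map T w x))" by (rule assms(3)[OF i])
    finally have 1: "c * (c ^ length w * norm x) \<le> norm (T i (word_map T w x))" .
    have "norm (T i (word_map T w x)) \<le> b * norm (word_map T w x)" by (rule assms(4)[OF i])
    also have "\<dots> \<le> b * (b ^ length w * norm x)"
      using IH(2) assms(2) by (intro mult_left_mono) auto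
    finally show ?case using 1 by (simp add: word_map_Cons mult.assoc)
  qed auto
  then show "c ^ length w * norm x \<le> norm (word_map T w x)"
    "norm (word_map T w x) \<le> b ^ length w * norm x" by auto
qed

end


subsection \<open>The pressure and the generalised dimensions for \<open>0 < q < 1\<close>\<close>

text \<open>Choose \<open>N\<close> with \<open>a N / N\<close> close to the infimum and divide
  \<open>n\<close> by \<open>N\<close> with remainder \<open>r\<close>. Then \<open>a n / n\<close>
  exceeds \<open>a N / N\<close> by at most \<open>M / n\<close>, where \<open>M\<close> bounds the
  contribution of all possible remainders.\<close>

lemma fekete_subadditive:
  fixes a :: "nat \<Rightarrow> real"
  assumes sub: "\<And>m n. a (m + n) \<le> a m + a n" and lower: "\<And>n. 1 \<le> n \<Longrightarrow> L \<le> a n / real n"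
  shows "convergent (\<lambda>n. a n / real n)"
proof -
  define l where "l = Inf ((\<lambda>n. a n / real n) ` {1..})"
  have bdd: "bdd_below ((\<lambda>n. a n / real n) ` {1..})"
    using lower by (intro bdd_belowI[of _ L]) auto
  have l_le: "l \<le> a n / real n" if "1 \<le> n" for n
    unfolding l_def using that bdd by (intro cInf_lower) auto
  have mult: "a (p * N + r) \<le> real p * a N + a r" for p N r
  proof (induction p)
    case (Suc p)
    have "a (Suc p * N + r) \<le> a N + a (p * N + r)"
      using sub[of N "p * N + r"] by (simp add: add.assoc)
    with Suc show ?case by (simp add: algebra_simps)
  qed simp
  have "(\<lambda>n. a n / real n) \<longlonglongrightarrow> l"
  proof (rule order_tendstoI)
    fix y assume "y < l"
    then show "\<forall>\<^sub>F n in sequentially. y < a n / real n"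
      using l_le by (intro eventually_sequentiallyI[of 1]) (auto intro: less_le_trans)
  next
    fix y assume "l < y"
    then obtain N where N: "1 \<le> N" "a N / real N < y"
      using cInf_lessD[of "(\<lambda>n. a n / real n) ` {1..}" y] by (auto simp: l_def)
    define x where "x = a N / real N"
    define M where "M = (\<Sum>r<N. \<bar>a r\<bar>) + real N * \<bar>x\<bar>"
    have le: "a n / real n \<le> x + M / real n" if n: "1 \<le> n" for n
    proof -
      define r where "r = n mod N"
      have r: "r < N" using N by (simp add: r_def)
      have n_eq: "n = (n div N) * N + r" by (simp add: r_def)
      have aN: "a N = real N * x" using N by (simp add: x_def)
      have "a n \<le> real (n div N) * (real N * x) + a r"
        using mult[of "n div N" N r] n_eq aN by simp
      also have "real (n div N) * (real N * x) = (real n - real r) * x"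
      proof -
        have "real n = real (n div N) * real N + real r"
          using n_eq by (metis of_nat_add of_nat_mult)
        then show ?thesis by simp
      qed
      also have "(real n - real r) * x + a r \<le> real n * x + M"
      proof -
        have "- (real r * x) \<le> real r * \<bar>x\<bar>"
          using mult_left_mono[of "- x" "\<bar>x\<bar>" "real r"] by simp
        also have "\<dots> \<le> real N * \<bar>x\<bar>"
          using r by (intro mult_right_mono) auto
        finally have "- (real r * x) \<le> real N * \<bar>x\<bar>" .
        moreover have "a r \<le> (\<Sum>r<N. \<bar>a r\<bar>)"
          using member_le_sum[of r "{..<N}" "\<lambda>r. \<bar>a r\<bar>"] r by auto
        ultimately show ?thesis by (simp add: M_def algebra_simps)
      qed
      finally show ?thesis using n by (simp add: field_simps)
    qed
    have "(\<lambda>n. x + M / real n) \<longlonglongrightarrow> x + 0"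
      by (intro tendsto_intros lim_const_over_n)
    then have "\<forall>\<^sub>F n in sequentially. x + M / real n < y"
      using N(2) by (auto simp: x_def dest: order_tendstoD(2))
    then show "\<forall>\<^sub>F n in sequentially. a n / real n < y"
      using eventually_ge_at_top[of 1] by eventually_elim (use le in force)
  qed
  then show ?thesis by (rule convergentI)
qed

section \<open>Partition sums, pressure and its zero\<close>

context gibbs_system
begin

text \<open>The partition sum behind the pressure: for \<open>0 < q < 1\<close> and
  \<open>s \<ge> 0\<close>, \<open>ln (Z s q k)\<close> grows like \<open>k * (q - 1)\<close> times
  the pressure.\<close>

definition Z :: "real \<Rightarrow> real \<Rightarrow> nat \<Rightarrow> real" where
  "Z s q k = (\<Sum>w\<in>words m k. sv_fun s (word_map T w) powr (1 - q) * prob (cylinder m w) powr q)"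

lemma pressure_eq_Z: "pressure m T \<mu> s q = lim (\<lambda>k. ln (Z s q k) / (q - 1) / real k)"
  by (simp add: pressure_def Z_def mult.commute[of "real _"])

lemma word_sv_fun_pos: "w \<in> words m k \<Longrightarrow> 0 \<le> s \<Longrightarrow> 0 < sv_fun s (word_map T w)"
  using word_map_linear[of w] by (intro sv_fun_pos) (auto simp: words_def)

lemma word_prob_pos: "w \<in> words m k \<Longrightarrow> 0 < prob (cylinder m w)"
  by (intro prob_cylinder_pos words_lists)

lemma words_nonempty: "words m k \<noteq> {}"
  using initial_seg_words[of "\<lambda>_. 1" m k] m by (auto simp: code_space_def)

lemma Z_pos: "0 \<le> s \<Longrightarrow> 0 < Z s q k"
  unfolding Z_def using word_sv_fun_pos word_prob_pos words_nonempty
  by (intro sum_pos finite_words) (force intro!: mult_pos_pos)+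

lemma Z_submultiplicative:
  assumes "0 \<le> s" "0 < q" "q < 1"
  obtains C where "1 \<le> C" "\<And>k l. Z s q (k + l) \<le> C * Z s q k * Z s q l"
proof -
  obtain C where C: "1 \<le> C"
    "\<And>S T :: real ^ 'n \<Rightarrow> real ^ 'n. linear S \<Longrightarrow> inj S \<Longrightarrow> linear T \<Longrightarrow> inj T \<Longrightarrow>
      sv_fun s (S \<circ> T) \<le> C * sv_fun s S * sv_fun s T"
    using sv_fun_comp[OF assms(1)] by metis
  obtain K where K: "1 \<le> K" "\<And>u w. u \<in> lists {1..m} \<Longrightarrow> w \<in> lists {1..m} \<Longrightarrow>
      prob (cylinder m (u @ w)) \<le> K * prob (cylinder m u) * prob (cylinder m w)"
    using quasi_bernoulli by metis
  define D where "D = C powr (1 - q) * K powr q"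
  define z where "z w = sv_fun s (word_map T w) powr (1 - q) * prob (cylinder m w) powr q" for w
  show thesis
  proof (rule that)
    have "1 \<le> C powr (1 - q)" "1 \<le> K powr q"
      using C(1) K(1) assms by (auto intro!: ge_one_powr_ge_zero)
    then show "1 \<le> D" unfolding D_def using mult_mono[of 1 "C powr (1 - q)" 1 "K powr q"] by simp
    fix k l
    have le: "z (u @ w) \<le> D * (z u * z w)" if u: "u \<in> words m k" and w: "w \<in> words m l" for u w
    proof -
      have uw: "u @ w \<in> words m (k + l)" using u w by (simp add: words_def)
      have "sv_fun s (word_map T (u @ w)) powr (1 - q) \<le>
          (C * sv_fun s (word_map T u) * sv_fun s (word_map T w)) powr (1 - q)"
        using C(2) word_map_linear[OF words_lists[OF u]] word_map_linear[OF words_lists[OF w]]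
          assms word_sv_fun_pos[OF uw assms(1)]
        by (intro powr_mono2) (auto simp: word_map_append)
      moreover have "prob (cylinder m (u @ w)) powr q \<le>
          (K * prob (cylinder m u) * prob (cylinder m w)) powr q"
        using K(2) words_lists[OF u] words_lists[OF w] assms by (intro powr_mono2) auto
      ultimately have "z (u @ w) \<le> (C * sv_fun s (word_map T u) * sv_fun s (word_map T w)) powr (1 - q) *
          (K * prob (cylinder m u) * prob (cylinder m w)) powr q"
        unfolding z_def by (intro mult_mono) auto
      also have "\<dots> = D * (z u * z w)"
        using C(1) K(1) word_sv_fun_pos[OF u assms(1)] word_sv_fun_pos[OF w assms(1)]
        by (simp add: z_def D_def powr_mult mult_ac)
      finally show ?thesis .
    qed
    have "Z s q (k + l) = (\<Sum>u\<in>words m k. \<Sum>w\<in>words m l. z (u @ w))"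
      unfolding Z_def z_def by (rule sum_words_add)
    also have "\<dots> \<le> (\<Sum>u\<in>words m k. \<Sum>w\<in>words m l. D * (z u * z w))"
      using le by (intro sum_mono) auto
    also have "\<dots> = D * (\<Sum>u\<in>words m k. \<Sum>w\<in>words m l. z u * z w)"
      by (simp add: sum_distrib_left)
    also have "\<dots> = D * Z s q k * Z s q l"
      by (simp add: Z_def z_def sum_product)
    finally show "Z s q (k + l) \<le> D * Z s q k * Z s q l" .
  qed
qed

text \<open>The singular values of a word map of length \<open>k\<close> lie between
  \<open>c ^ k\<close> and \<open>b ^ k\<close>. One pair of constants serves all \<open>s\<close>,
  \<open>t\<close>, \<open>q\<close> and \<open>k\<close>, so the estimates survive the
  limit.\<close>

lemma Z_increment:
  obtains b c where "0 < c" "c < 1" "0 < b" "b < 1"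
    "\<And>s t q k. 0 \<le> s \<Longrightarrow> s \<le> t \<Longrightarrow> q < 1 \<Longrightarrow>
      real k * ((t - s) * (1 - q) * ln c) + ln (Z s q k) \<le> ln (Z t q k)"
    "\<And>s t q k. 0 \<le> s \<Longrightarrow> s \<le> t \<Longrightarrow> q < 1 \<Longrightarrow>
      ln (Z t q k) \<le> real k * ((t - s) * (1 - q) * ln b) + ln (Z s q k)"
proof -
  obtain b c where bc: "0 < c" "c < 1" "0 < b" "b < 1"
    and bnd: "\<And>i x. i \<in> {1..m} \<Longrightarrow> c * norm x \<le> norm (T i x)"
      "\<And>i x. i \<in> {1..m} \<Longrightarrow> norm (T i x) \<le> b * norm x"
    using contraction_constants by metis
  have inc: "(c ^ k) powr ((t - s) * (1 - q)) * Z s q k \<le> Z t q k"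
      "Z t q k \<le> (b ^ k) powr ((t - s) * (1 - q)) * Z s q k"
    if st: "0 \<le> s" "s \<le> t" "q < 1" for s t q k
  proof -
    have sv: "(c ^ k) powr (t - s) * sv_fun s (word_map T w) \<le> sv_fun t (word_map T w)"
        "sv_fun t (word_map T w) \<le> (b ^ k) powr (t - s) * sv_fun s (word_map T w)"
      if w: "w \<in> words m k" for w
      using word_map_linear[OF words_lists[OF w]] word_map_bounds[OF bc(1,3) bnd words_lists[OF w]] bc st w
        sv_fun_increment[of "word_map T w" "c ^ k" "b ^ k" s t]
      by (auto simp: words_def)
    have eq: "x powr ((t - s) * (1 - q)) * Z s q k =
        (\<Sum>w\<in>words m k. (x powr (t - s) * sv_fun s (word_map T w)) powr (1 - q) * prob (cylinder m w) powr q)"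
      if "0 < x" for x
      unfolding Z_def sum_distrib_left using that word_sv_fun_pos[OF _ st(1)]
      by (intro sum.cong) (auto simp: powr_mult powr_powr less_imp_le)
    show "(c ^ k) powr ((t - s) * (1 - q)) * Z s q k \<le> Z t q k"
      unfolding eq[OF zero_less_power[OF bc(1)]] unfolding Z_def
      using sv st word_sv_fun_pos[OF _ st(1), THEN less_imp_le]
      by (intro sum_mono mult_right_mono powr_mono2) auto
    show "Z t q k \<le> (b ^ k) powr ((t - s) * (1 - q)) * Z s q k"
      unfolding eq[OF zero_less_power[OF bc(3)]] unfolding Z_def
      using sv st word_sv_fun_pos[of _ k t, THEN less_imp_le]
      by (intro sum_mono mult_right_mono powr_mono2) auto
  qed
  have lnx: "ln ((x ^ k) powr y * z) = real k * (y * ln x) + ln z" if "0 < x" "0 < z" for x y z :: real and k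
    using that by (simp add: ln_mult ln_powr ln_realpow)
  show thesis
  proof (rule that[OF bc])
    fix s t q :: real and k assume st: "0 \<le> s" "s \<le> t" "q < 1"
    have pos: "0 < Z s q k" "0 < Z t q k" using Z_pos st by auto
    have "ln ((c ^ k) powr ((t - s) * (1 - q)) * Z s q k) \<le> ln (Z t q k)"
      using inc(1)[OF st] pos bc by (subst ln_le_cancel_iff) auto
    then show "real k * ((t - s) * (1 - q) * ln c) + ln (Z s q k) \<le> ln (Z t q k)"
      using lnx[OF bc(1) pos(1)] by simp
    have "ln (Z t q k) \<le> ln ((b ^ k) powr ((t - s) * (1 - q)) * Z s q k)"
      using inc(2)[OF st] pos bc by (subst ln_le_cancel_iff) auto
    then show "ln (Z t q k) \<le> real k * ((t - s) * (1 - q) * ln b) + ln (Z s q k)"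
      using lnx[OF bc(3) pos(1)] by simp
  qed
qed

text \<open>Since phi^0 = 1, the sum is that of mu(C_w)^(q-1) mu(C_w), and the first factor is at
  least \<open>(\<theta> ^ k) powr (q - 1)\<close> because \<open>q - 1\<close> is negative. This is
  what makes the pressure at 0 negative and \<open>gen_dim\<close> positive.\<close>

lemma Z_zero_ge:
  obtains \<theta> where "0 < \<theta>" "\<theta> < 1"
    "\<And>q k. q < 1 \<Longrightarrow> real k * ((q - 1) * ln \<theta>) \<le> ln (Z 0 q k)"
proof -
  obtain \<theta> where \<theta>: "0 < \<theta>" "\<theta> < 1" "\<And>w. w \<in> lists {1..m} \<Longrightarrow> prob (cylinder m w) \<le> \<theta> ^ length w"
    using prob_cylinder_decay by metis
  show thesis
  proof (rule that[OF \<theta>(1,2)])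
    fix q :: real and k assume q: "q < 1"
    have "(\<theta> ^ k) powr (q - 1) = (\<Sum>w\<in>words m k. (\<theta> ^ k) powr (q - 1) * prob (cylinder m w))"
      by (simp add: sum_prob_cylinder flip: sum_distrib_left)
    also have "\<dots> \<le> Z 0 q k"
      unfolding Z_def
    proof (rule sum_mono)
      fix w assume w: "w \<in> words m k"
      have p: "0 < prob (cylinder m w)" by (rule word_prob_pos[OF w])
      have "(\<theta> ^ k) powr (q - 1) \<le> prob (cylinder m w) powr (q - 1)"
        using \<theta>(3)[OF words_lists[OF w]] w p q by (intro powr_mono2') (auto simp: words_def)
      then have "(\<theta> ^ k) powr (q - 1) * prob (cylinder m w) \<le>
          prob (cylinder m w) powr (q - 1) * prob (cylinder m w) powr 1"
        by (simp add: mult_right_mono)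
      also have "\<dots> = prob (cylinder m w) powr q"
        by (subst powr_add[symmetric]) simp
      finally show "(\<theta> ^ k) powr (q - 1) * prob (cylinder m w) \<le>
          sv_fun 0 (word_map T w) powr (1 - q) * prob (cylinder m w) powr q"
        by (simp add: sv_fun_def)
    qed
    finally have "ln ((\<theta> ^ k) powr (q - 1)) \<le> ln (Z 0 q k)"
      using Z_pos[of 0 q k] \<theta> by (subst ln_le_cancel_iff) auto
    then show "real k * ((q - 1) * ln \<theta>) \<le> ln (Z 0 q k)"
      using \<theta> by (simp add: ln_powr ln_realpow mult_ac)
  qed
qed

lemma pressure_limit:
  assumes s: "0 \<le> s" and q: "0 < q" "q < 1"
  shows "(\<lambda>k. ln (Z s q k) / (q - 1) / real k) \<longlonglongrightarrow> pressure m T \<mu> s q"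
proof -
  obtain C where C: "1 \<le> C" "\<And>k l. Z s q (k + l) \<le> C * Z s q k * Z s q l"
    using Z_submultiplicative[OF assms] by metis
  obtain c where c: "0 < c" "c < 1" "\<And>s t q k. 0 \<le> s \<Longrightarrow> s \<le> t \<Longrightarrow> q < 1 \<Longrightarrow>
      real k * ((t - s) * (1 - q) * ln c) + ln (Z s q k) \<le> ln (Z t q k)"
    using Z_increment by metis
  obtain \<theta> where \<theta>: "0 < \<theta>" "\<theta> < 1" "\<And>q k. q < 1 \<Longrightarrow> real k * ((q - 1) * ln \<theta>) \<le> ln (Z 0 q k)"
    using Z_zero_ge by metis
  \<comment> \<open>Adding \<open>ln C\<close> makes the sequence exactly subadditive and disappears
    after division by \<open>k\<close>.\<close>
  define a where "a k = ln (Z s q k) + ln C" for k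
  have "convergent (\<lambda>k. a k / real k)"
  proof (rule fekete_subadditive)
    fix k l
    have "ln (Z s q (k + l)) \<le> ln (C * Z s q k * Z s q l)"
      using C Z_pos[OF s] by (subst ln_le_cancel_iff) auto
    then show "a (k + l) \<le> a k + a l"
      using C(1) Z_pos[OF s, of q] less_imp_neq[OF Z_pos[OF s, of q]]
      by (simp add: a_def ln_mult)
  next
    fix k :: nat assume k: "1 \<le> k"
    \<comment> \<open>The lower bound for Fekete's lemma: \<open>ln (Z 0 q k)\<close> is
      nonnegative, and passing from 0 to \<open>s\<close> costs at most
      \<open>s * (1 - q) * \<bar>ln c\<bar>\<close> per letter.\<close>
    have "0 \<le> (q - 1) * ln \<theta>" using \<theta> q by (intro mult_nonpos_nonpos) auto
    then have "0 \<le> ln (Z 0 q k)"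
      using \<theta>(3)[OF q(2), of k] by (meson mult_nonneg_nonneg of_nat_0_le_iff order_trans)
    moreover have "0 \<le> ln C" using C(1) by simp
    moreover have "real k * ((s - 0) * (1 - q) * ln c) + ln (Z 0 q k) \<le> ln (Z s q k)"
      by (rule c(3)) (use s q in auto)
    ultimately have "s * (1 - q) * ln c * real k \<le> a k"
      by (simp add: a_def mult_ac)
    then show "s * (1 - q) * ln c \<le> a k / real k"
      using k by (simp add: pos_le_divide_eq)
  qed
  then obtain L where L: "(\<lambda>k. a k / real k) \<longlonglongrightarrow> L" by (auto simp: convergent_def)
  have "(\<lambda>k. (a k / real k - ln C / real k) / (q - 1)) \<longlonglongrightarrow> (L - 0) / (q - 1)"
    using q by (intro tendsto_intros L lim_const_over_n) auto
  then have "(\<lambda>k. ln (Z s q k) / (q - 1) / real k) \<longlonglongrightarrow> L / (q - 1)"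
    by (simp add: a_def add_divide_distrib mult.commute)
  then show ?thesis
    unfolding pressure_eq_Z using limI by (metis (no_types, lifting))
qed

text \<open>Dividing by \<open>q - 1 < 0\<close> turns the decrease of \<open>ln Z\<close> in
  \<open>s\<close> into an increase and cancels \<open>1 - q\<close>. Hence the slopes
  \<open>- ln b\<close> and \<open>- ln c\<close> do not depend on \<open>q\<close>.\<close>

lemma pressure_increment:
  obtains l L where "0 < l"
    "\<And>s t q. 0 \<le> s \<Longrightarrow> s \<le> t \<Longrightarrow> 0 < q \<Longrightarrow> q < 1 \<Longrightarrow>
      pressure m T \<mu> s q + l * (t - s) \<le> pressure m T \<mu> t q"
    "\<And>s t q. 0 \<le> s \<Longrightarrow> s \<le> t \<Longrightarrow> 0 < q \<Longrightarrow> q < 1 \<Longrightarrow>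
      pressure m T \<mu> t q \<le> pressure m T \<mu> s q + L * (t - s)"
proof -
  obtain b c where bc: "0 < c" "c < 1" "0 < b" "b < 1" 
    and inc: "\<And>s t q k. 0 \<le> s \<Longrightarrow> s \<le> t \<Longrightarrow> q < 1 \<Longrightarrow>
      real k * ((t - s) * (1 - q) * ln c) + ln (Z s q k) \<le> ln (Z t q k)"
    "\<And>s t q k. 0 \<le> s \<Longrightarrow> s \<le> t \<Longrightarrow> q < 1 \<Longrightarrow>
      ln (Z t q k) \<le> real k * ((t - s) * (1 - q) * ln b) + ln (Z s q k)"
    using Z_increment by metis
  show thesis
  proof (rule that)
    show "0 < - ln b" using bc by simp
    fix s t q :: real assume st: "0 \<le> s" "s \<le> t" and q: "0 < q" "q < 1"
    note lims = pressure_limit[OF st(1) q] pressure_limit[OF order_trans[OF st] q]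
    have eq: "(real k * ((t - s) * (1 - q) * z) + y) / (q - 1) / real k = y / (q - 1) / real k + - z * (t - s)"
      if "1 \<le> k" for y z and k :: nat
    proof -
      have "real k * ((t - s) * (1 - q) * z) = (- z * (t - s)) * real k * (q - 1)"
        by (simp add: algebra_simps)
      then show ?thesis
        using that q by (simp add: add_divide_distrib diff_divide_distrib)
    qed
    show "pressure m T \<mu> s q + - ln b * (t - s) \<le> pressure m T \<mu> t q"
    proof (rule LIMSEQ_le)
      show "(\<lambda>k. ln (Z s q k) / (q - 1) / real k + - ln b * (t - s)) \<longlonglongrightarrow>
          pressure m T \<mu> s q + - ln b * (t - s)"
        by (intro tendsto_intros lims)
      show "\<exists>N. \<forall>k\<ge>N. ln (Z s q k) / (q - 1) / real k + - ln b * (t - s) \<le> ln (Z t q k) / (q - 1) / real k"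
      proof (intro exI[of _ 1] allI impI)
        fix k :: nat assume k: "1 \<le> k"
        show "ln (Z s q k) / (q - 1) / real k + - ln b * (t - s) \<le> ln (Z t q k) / (q - 1) / real k"
          unfolding eq[OF k, symmetric] using inc(2)[OF st q(2)] q
          by (intro divide_right_mono divide_right_mono_neg) auto
      qed
    qed (rule lims)
    show "pressure m T \<mu> t q \<le> pressure m T \<mu> s q + - ln c * (t - s)"
    proof (rule LIMSEQ_le)
      show "(\<lambda>k. ln (Z s q k) / (q - 1) / real k + - ln c * (t - s)) \<longlonglongrightarrow>
          pressure m T \<mu> s q + - ln c * (t - s)"
        by (intro tendsto_intros lims)
      show "\<exists>N. \<forall>k\<ge>N. ln (Z t q k) / (q - 1) / real k \<le> ln (Z s q k) / (q - 1) / real k + - ln c * (t - s)"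
      proof (intro exI[of _ 1] allI impI)
        fix k :: nat assume k: "1 \<le> k"
        show "ln (Z t q k) / (q - 1) / real k \<le> ln (Z s q k) / (q - 1) / real k + - ln c * (t - s)"
          unfolding eq[OF k, symmetric] using inc(1)[OF st q(2)] q
          by (intro divide_right_mono divide_right_mono_neg) auto
      qed
    qed (rule lims)
  qed
qed

lemma pressure_zero_neg:
  assumes q: "0 < q" "q < 1"
  shows "pressure m T \<mu> 0 q < 0"
proof -
  obtain \<theta> where \<theta>: "0 < \<theta>" "\<theta> < 1" "\<And>q k. q < 1 \<Longrightarrow> real k * ((q - 1) * ln \<theta>) \<le> ln (Z 0 q k)"
    using Z_zero_ge by metis
  have "pressure m T \<mu> 0 q \<le> ln \<theta>"
  proof (rule LIMSEQ_le_const2[OF pressure_limit[OF order_refl q]])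
    show "\<exists>N. \<forall>k\<ge>N. ln (Z 0 q k) / (q - 1) / real k \<le> ln \<theta>"
      using \<theta>(3)[OF q(2)] q by (intro exI[of _ 1]) (auto simp: field_simps)
  qed
  also have "\<dots> < 0" using \<theta> by simp
  finally show ?thesis .
qed

text \<open>The definite description needs exactly one zero. Existence is the intermediate value
  theorem for a Lipschitz function, uniqueness the lower slope bound.\<close>

lemma gen_dim:
  assumes q: "0 < q" "q < 1"
  shows "0 < gen_dim m T \<mu> q" "pressure m T \<mu> (gen_dim m T \<mu> q) q = 0"
proof -
  obtain l L where l: "0 < l"
    and inc: "\<And>s t. 0 \<le> s \<Longrightarrow> s \<le> t \<Longrightarrow> pressure m T \<mu> s q + l * (t - s) \<le> pressure m T \<mu> t q"
      "\<And>s t. 0 \<le> s \<Longrightarrow> s \<le> t \<Longrightarrow> pressure m T \<mu> t q \<le> pressure m T \<mu> s q + L * (t - s)"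
    using pressure_increment q by metis
  let ?p = "\<lambda>s. pressure m T \<mu> s q"
  have lip: "\<bar>?p s - ?p t\<bar> \<le> \<bar>L\<bar> * \<bar>s - t\<bar>" if "0 \<le> s" "0 \<le> t" for s t
  proof -
    have *: "\<bar>?p s - ?p t\<bar> \<le> \<bar>L\<bar> * \<bar>s - t\<bar>" if "0 \<le> s" "s \<le> t" for s t
    proof -
      have "0 \<le> l * (t - s)" using l that by simp
      moreover have "L * (t - s) \<le> \<bar>L\<bar> * (t - s)" using that by (intro mult_right_mono) auto
      ultimately show ?thesis using inc(1)[OF that] inc(2)[OF that] that
        by (simp add: abs_minus_commute[of s t])
    qed
    show ?thesis using *[of s t] *[of t s] that by (cases "s \<le> t") (auto simp: abs_minus_commute)
  qed
  have "\<bar>L\<bar>-lipschitz_on {0..} ?p"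
    using lip by (intro lipschitz_onI) (auto simp: dist_real_def)
  then have cont: "continuous_on {0..} ?p"
    by (rule lipschitz_on_continuous_on)
  \<comment> \<open>Growing with slope at least \<open>l\<close> from the negative value at 0, the
    pressure has reached 0 by \<open>M\<close>.\<close>
  define M where "M = - ?p 0 / l"
  have M: "0 < M" using pressure_zero_neg[OF q] l by (simp add: M_def divide_neg_pos)
  have "0 \<le> ?p M" using inc(1)[of 0 M] M l by (simp add: M_def)
  then obtain d where d: "0 \<le> d" "?p d = 0"
    using IVT'[of ?p 0 0 M] pressure_zero_neg[OF q] M continuous_on_subset[OF cont, of "{0..M}"] by force
  have "0 < d" using d pressure_zero_neg[OF q] by (cases "d = 0") auto
  have uniq: "e = d" if "e > 0 \<and> ?p e = 0" for e
  proof (rule ccontr)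
    assume "e \<noteq> d"
    then have "0 < l * \<bar>e - d\<bar>" using l by simp
    then show False using inc(1)[of d e] inc(1)[of e d] d that by (cases "e \<le> d") auto
  qed
  have "gen_dim m T \<mu> q > 0 \<and> ?p (gen_dim m T \<mu> q) = 0"
    unfolding gen_dim_def by (rule theI', rule ex1I[of _ d]) (use \<open>0 < d\<close> d uniq in blast)+
  then show "0 < gen_dim m T \<mu> q" "?p (gen_dim m T \<mu> q) = 0" by auto
qed

lemma pressure_pos:
  assumes q: "0 < q" "q < 1" and s: "gen_dim m T \<mu> q < s"
  shows "0 < pressure m T \<mu> s q"
proof -
  obtain l where l: "0 < l"
    and inc: "\<And>s t. 0 \<le> s \<Longrightarrow> s \<le> t \<Longrightarrow> pressure m T \<mu> s q + l * (t - s) \<le> pressure m T \<mu> t q"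
    using pressure_increment q by metis
  have "0 < l * (s - gen_dim m T \<mu> q)" using l s by simp
  then show ?thesis
    using inc[of "gen_dim m T \<mu> q" s] gen_dim[OF q] s by simp
qed

text \<open>
  With \<open>Y = \<phi>\<^sup>s / \<mu>\<close> the sum \<open>Z\<close> is the \<open>(1 - q)\<close>-th moment of \<open>Y\<close> under \<open>\<mu>\<close>, so this is
  Lyapunov's inequality between moments.
\<close>

lemma pressure_mono_q:
  assumes s: "0 \<le> s" and q: "0 < q" "q \<le> q'" "q' < 1"
  shows "pressure m T \<mu> s q \<le> pressure m T \<mu> s q'"
proof (rule LIMSEQ_le)
  show "(\<lambda>k. ln (Z s q k) / (q - 1) / real k) \<longlonglongrightarrow> pressure m T \<mu> s q"
    "(\<lambda>k. ln (Z s q' k) / (q' - 1) / real k) \<longlonglongrightarrow> pressure m T \<mu> s q'"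
    using s q by (auto intro!: pressure_limit simp del: divide_divide_eq_left)
  define e where "e = (1 - q) / (1 - q')"
  have e: "1 \<le> e" using q by (simp add: e_def)
  show "\<exists>N. \<forall>k\<ge>N. ln (Z s q k) / (q - 1) / real k \<le> ln (Z s q' k) / (q' - 1) / real k"
  proof (intro exI[of _ 1] allI impI)
    fix k :: nat assume k: "1 \<le> k"
    define Y where "Y w = sv_fun s (word_map T w) / prob (cylinder m w)" for w
    have Y: "0 < Y w" if "w \<in> words m k" for w
      using word_sv_fun_pos[OF that s] word_prob_pos[OF that] by (simp add: Y_def)
    have ZY: "Z s r k = (\<Sum>w\<in>words m k. prob (cylinder m w) * Y w powr (1 - r))" for r
      unfolding Z_def
    proof (rule sum.cong)
      fix w assume w: "w \<in> words m k"
      have p: "0 < prob (cylinder m w)" by (rule word_prob_pos[OF w])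
      have "prob (cylinder m w) powr r = prob (cylinder m w) powr 1 / prob (cylinder m w) powr (1 - r)"
        by (subst powr_diff[symmetric]) simp
      then show "sv_fun s (word_map T w) powr (1 - r) * prob (cylinder m w) powr r =
          prob (cylinder m w) * Y w powr (1 - r)"
        using p word_sv_fun_pos[OF w s] by (simp add: Y_def powr_divide less_imp_le)
    qed simp
    have "(\<Sum>w\<in>words m k. prob (cylinder m w) *\<^sub>R (Y w powr (1 - q'))) powr e \<le>
        (\<Sum>w\<in>words m k. prob (cylinder m w) * (Y w powr (1 - q')) powr e)"
      using e
      by (intro convex_on_sum[where C = "{0<..}" and f = "\<lambda>x. x powr e"] finite_words words_nonempty
          powr_convex sum_prob_cylinder) (auto dest!: Y)
    also have "\<dots> = Z s q k"
      unfolding ZY using q by (intro sum.cong) (auto simp: powr_powr e_def)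
    finally have "Z s q' k powr e \<le> Z s q k"
      by (simp add: ZY)
    then have "ln (Z s q' k powr e) \<le> ln (Z s q k)"
      using Z_pos[OF s] less_imp_neq[OF Z_pos[OF s]] by (subst ln_le_cancel_iff) auto
    then have "e * ln (Z s q' k) \<le> ln (Z s q k)"
      by (simp add: ln_powr)
    then have "ln (Z s q k) / (q - 1) \<le> ln (Z s q' k) / (q' - 1)"
      using q by (simp add: e_def field_simps)
    then show "ln (Z s q k) / (q - 1) / real k \<le> ln (Z s q' k) / (q' - 1) / real k"
      by (rule divide_right_mono) simp
  qed
qed

text \<open>Otherwise the pressure for \<open>q'\<close> would be nonnegative at the smaller
  dimension by \<open>pressure_mono_q\<close>, hence strictly positive at the larger one, which is
  its zero.\<close>

lemma gen_dim_antimono: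
  assumes q: "0 < q" "q \<le> q'" "q' < 1"
  shows "gen_dim m T \<mu> q' \<le> gen_dim m T \<mu> q"
proof (rule ccontr)
  assume "\<not> ?thesis"
  then have less: "gen_dim m T \<mu> q < gen_dim m T \<mu> q'" by simp
  have d: "0 < gen_dim m T \<mu> q" "pressure m T \<mu> (gen_dim m T \<mu> q) q = 0"
    using gen_dim q by auto
  obtain l where l: "0 < l"
    and inc: "\<And>s t. 0 \<le> s \<Longrightarrow> s \<le> t \<Longrightarrow> pressure m T \<mu> s q' + l * (t - s) \<le> pressure m T \<mu> t q'"
    using pressure_increment q by (metis less_le_trans)
  have "0 < l * (gen_dim m T \<mu> q' - gen_dim m T \<mu> q)" using l less by simp
  moreover have "0 \<le> pressure m T \<mu> (gen_dim m T \<mu> q) q'"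
    using pressure_mono_q[OF less_imp_le[OF d(1)] q] d(2) by simp
  ultimately show False
    using inc[OF less_imp_le[OF d(1)] less_imp_le[OF less]] gen_dim(2)[of q'] q by simp
qed

text \<open>An antitone function bounded below converges from the left to its infimum. So
  \<open>Lim\<close> denotes a true limit, and an \<open>s\<close> above it already exceeds the
  value at some \<open>q < 1\<close>.\<close>

lemma gen_dim_less_of_Lim_less:
  assumes "Lim (at_left 1) (gen_dim m T \<mu>) < s"
  obtains q where "0 < q" "q < 1" "gen_dim m T \<mu> q < s"
proof -
  define D where "D = Inf (gen_dim m T \<mu> ` {0<..<1})"
  have bdd: "bdd_below (gen_dim m T \<mu> ` {0<..<1})"
    using gen_dim(1) by (intro bdd_belowI[of _ 0]) (auto intro: less_imp_le)
  have ne: "gen_dim m T \<mu> ` {0<..<1} \<noteq> {}" by simp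
  have "(gen_dim m T \<mu> \<longlongrightarrow> D) (at_left 1)"
  proof (rule order_tendstoI)
    fix y assume "y < D"
    then have "y < gen_dim m T \<mu> q" if "0 < q" "q < 1" for q
      using cInf_lower[OF _ bdd, of "gen_dim m T \<mu> q"] that unfolding D_def[symmetric] by force
    then show "\<forall>\<^sub>F q in at_left 1. y < gen_dim m T \<mu> q"
      unfolding eventually_at_left_field by (intro exI[of _ 0]) auto
  next
    fix y assume "D < y"
    then obtain q where "0 < q" "q < 1" "gen_dim m T \<mu> q < y"
      using cInf_lessD[OF ne, of y] unfolding D_def by auto
    then show "\<forall>\<^sub>F q in at_left 1. gen_dim m T \<mu> q < y"
      unfolding eventually_at_left_field
      by (intro exI[of _ q] conjI allI impI) (auto intro: le_less_trans[OF gen_dim_antimono])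
  qed
  then have "Lim (at_left 1) (gen_dim m T \<mu>) = D"
    by (intro tendsto_Lim) (simp_all add: trivial_limit_at_left_real)
  then show thesis
    using assms cInf_lessD[OF ne, of s] that unfolding D_def by auto
qed

text \<open>As \<open>q - 1\<close> is negative, positive pressure means exponential decay of the
  sums. Half the pressure serves as a rate that is reached after finitely many
  \<open>k\<close>.\<close>

lemma summable_Z:
  assumes s: "0 \<le> s" and q: "0 < q" "q < 1" and pos: "0 < pressure m T \<mu> s q"
  shows "summable (Z s q)"
proof -
  define p where "p = pressure m T \<mu> s q / 2"
  have p: "0 < p" "p < pressure m T \<mu> s q" using pos by (auto simp: p_def)
  have "\<forall>\<^sub>F k in sequentially. p < ln (Z s q k) / (q - 1) / real k"
    using order_tendstoD(1)[OF pressure_limit[OF s q] p(2)] .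
  then have "\<forall>\<^sub>F k in sequentially. norm (Z s q k) \<le> exp (- (1 - q) * p) ^ k"
    using eventually_ge_at_top[of 1]
  proof eventually_elim
    case (elim k)
    then have "ln (Z s q k) \<le> real k * (- (1 - q) * p)"
      using q by (simp add: field_simps)
    then have "exp (ln (Z s q k)) \<le> exp (real k * (- (1 - q) * p))" by simp
    then show ?case
      using Z_pos[OF s, of q k] by (simp add: exp_of_nat_mult)
  qed
  moreover have "summable (\<lambda>k. exp (- (1 - q) * p) ^ k)"
    using p q by (intro summable_geometric) (simp add: mult_neg_pos)
  ultimately show ?thesis
    by (rule summable_comparison_test_ev)
qed

end


subsection \<open>Lower bounds for the measure of balls\<close>

text \<open>A covering ball that contains \<open>X i\<close> is contained in the ball of twice the
  radius around \<open>X i\<close>, so a light centred ball forces a light covering ball. The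
  preimages of the light covering balls form a set that is measurable by construction and consists
  of at most \<open>card F\<close> pieces of measure below \<open>\<delta>\<close>.\<close>

lemma small_ball_exceptional_set:
  fixes X :: "'a \<Rightarrow> 'b::euclidean_space"
  assumes "prob_space M" and X[measurable]: "X \<in> borel_measurable M" and C[measurable]: "C \<in> sets M"
    and F: "finite F" "X ` C \<subseteq> (\<Union>y\<in>F. cball y \<rho>)" and \<delta>: "0 \<le> \<delta>"
  obtains G where "G \<in> sets M" "G \<subseteq> C" "measure M G \<le> real (card F) * \<delta>"
    "\<And>i. i \<in> C \<Longrightarrow> measure (distr M borel X) (cball (X i) (2 * \<rho>)) < \<delta> \<Longrightarrow> i \<in> G"
proof -
  interpret prob_space M by fact
  interpret \<nu>: prob_space "distr M borel X"
    by (rule prob_space_distr) simp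
  define F' where "F' = {y \<in> F. measure (distr M borel X) (cball y \<rho>) < \<delta>}"
  define V where "V y = X -` cball y \<rho> \<inter> space M" for y
  have V[measurable]: "V y \<in> sets M" for y unfolding V_def by measurable
  define G where "G = C \<inter> (\<Union>y\<in>F'. V y)"
  have F': "finite F'" "card F' \<le> card F"
    using F(1) by (auto simp: F'_def intro: card_mono)
  show thesis
  proof (rule that)
    show "G \<in> sets M" "G \<subseteq> C"
      using F'(1) by (auto simp: G_def intro!: sets.Int sets.finite_UN)
    have "measure M G \<le> measure M (\<Union>y\<in>F'. V y)"
      unfolding G_def using F'(1) by (intro finite_measure_mono sets.finite_UN) auto
    also have "\<dots> \<le> (\<Sum>y\<in>F'. measure M (V y))"
      using F'(1) by (intro finite_measure_subadditive_finite) auto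
    also have "\<dots> \<le> (\<Sum>y\<in>F'. \<delta>)"
      by (intro sum_mono) (auto simp: F'_def V_def measure_distr)
    also have "\<dots> \<le> real (card F) * \<delta>"
      using F'(2) \<delta> by (simp add: mult_right_mono)
    finally show "measure M G \<le> real (card F) * \<delta>" .
  next
    fix i assume i: "i \<in> C" "measure (distr M borel X) (cball (X i) (2 * \<rho>)) < \<delta>"
    then obtain y where y: "y \<in> F" "X i \<in> cball y \<rho>" using F(2) by blast
    have "cball y \<rho> \<subseteq> cball (X i) (2 * \<rho>)"
    proof
      fix z assume "z \<in> cball y \<rho>"
      with y(2) show "z \<in> cball (X i) (2 * \<rho>)"
        using dist_triangle[of "X i" z y] by (simp add: dist_commute)
    qed
    then have "measure (distr M borel X) (cball y \<rho>) < \<delta>"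
      using i(2) \<nu>.finite_measure_mono[of "cball y \<rho>" "cball (X i) (2 * \<rho>)"] by simp
    then show "i \<in> G"
      using i(1) y sets.sets_into_space[OF C] by (auto simp: G_def F'_def V_def)
  qed
qed

text \<open>Borel-Cantelli for the exceptional sets, each of which is bounded both by its cylinder
  and by its cover. The index sets \<open>W k\<close> are abstract so that the words of length
  \<open>k\<close> and a single index for the whole code space both fit.\<close>

lemma AE_eventually_large_balls:
  fixes X :: "'a \<Rightarrow> 'b::euclidean_space" and W :: "nat \<Rightarrow> 'w set"
  assumes M: "prob_space M" and X: "X \<in> borel_measurable M"
    and W: "\<And>k. finite (W k)" and C: "\<And>k w. w \<in> W k \<Longrightarrow> C k w \<in> sets M"
    and F: "\<And>k w. w \<in> W k \<Longrightarrow> finite (F k w)"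
      "\<And>k w. w \<in> W k \<Longrightarrow> X ` C k w \<subseteq> (\<Union>y\<in>F k w. cball y (\<rho> k w))"
    and \<delta>: "\<And>k w. w \<in> W k \<Longrightarrow> 0 \<le> \<delta> k w"
    and e: "\<And>k w. w \<in> W k \<Longrightarrow> min (measure M (C k w)) (real (card (F k w)) * \<delta> k w) \<le> e k w"
    and sum: "summable (\<lambda>k. \<Sum>w\<in>W k. e k w)"
  shows "AE i in M. \<forall>\<^sub>F k in sequentially. \<forall>w\<in>W k. i \<in> C k w \<longrightarrow>
    \<delta> k w \<le> measure (distr M borel X) (cball (X i) (2 * \<rho> k w))"
proof -
  interpret prob_space M by fact
  have "\<forall>k. \<forall>w\<in>W k. \<exists>G. G \<in> sets M \<and> G \<subseteq> C k w \<and> measure M G \<le> real (card (F k w)) * \<delta> k w \<and>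
    (\<forall>i\<in>C k w. measure (distr M borel X) (cball (X i) (2 * \<rho> k w)) < \<delta> k w \<longrightarrow> i \<in> G)"
    using small_ball_exceptional_set[OF M X C F \<delta>] by metis
  then obtain G where G: "\<And>k w. w \<in> W k \<Longrightarrow> G k w \<in> sets M"
    "\<And>k w. w \<in> W k \<Longrightarrow> G k w \<subseteq> C k w"
    "\<And>k w. w \<in> W k \<Longrightarrow> measure M (G k w) \<le> real (card (F k w)) * \<delta> k w"
    "\<And>k w i. w \<in> W k \<Longrightarrow> i \<in> C k w \<Longrightarrow>
      measure (distr M borel X) (cball (X i) (2 * \<rho> k w)) < \<delta> k w \<Longrightarrow> i \<in> G k w"
    by metis
  define U where "U k = (\<Union>w\<in>W k. G k w)" for k
  have U: "U k \<in> sets M" for k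
    unfolding U_def using W G(1) by (intro sets.finite_UN) auto
  have Ge: "measure M (G k w) \<le> e k w" if "w \<in> W k" for k w
    using G(3)[OF that] e[OF that] finite_measure_mono[OF G(2)[OF that] C[OF that]] by linarith
  have "measure M (U k) \<le> (\<Sum>w\<in>W k. e k w)" for k
  proof -
    have "measure M (U k) \<le> (\<Sum>w\<in>W k. measure M (G k w))"
      unfolding U_def using W G(1) by (intro finite_measure_subadditive_finite) auto
    also have "\<dots> \<le> (\<Sum>w\<in>W k. e k w)" by (intro sum_mono Ge)
    finally show ?thesis .
  qed
  then have "summable (\<lambda>k. measure M (U k))"
    by (intro summable_comparison_test[OF _ sum]) (auto intro: exI[of _ 0])
  then have "AE i in M. \<forall>\<^sub>F k in sequentially. i \<in> space M - U k"
    using U by (intro borel_cantelli_AE1) (auto simp: emeasure_eq_measure)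
  then show ?thesis
  proof (rule AE_mp, intro AE_I2 impI)
    fix i assume "\<forall>\<^sub>F k in sequentially. i \<in> space M - U k"
    then show "\<forall>\<^sub>F k in sequentially. \<forall>w\<in>W k. i \<in> C k w \<longrightarrow>
        \<delta> k w \<le> measure (distr M borel X) (cball (X i) (2 * \<rho> k w))"
      by eventually_elim (use G(4) in \<open>force simp: U_def not_less[symmetric]\<close>)
  qed
qed

text \<open>A small \<open>R\<close> lies between two consecutive values of \<open>K * r k\<close>.
  The loss is the factor \<open>(c / K) powr s\<close>, which dominates
  \<open>R powr (t - s)\<close> once \<open>R\<close> is below the second term of
  \<open>R0\<close>.\<close>

lemma eventually_ball_lower_bound:
  fixes x :: "'a::euclidean_space"
  assumes "finite_measure \<nu>" and sets: "sets \<nu> = sets borel"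
    and r: "\<And>k. 0 < r k" "r \<longlonglongrightarrow> 0" and c: "0 < c" "\<And>k. c * r k \<le> r (Suc k)" and K: "0 < K"
    and s: "0 \<le> s" "s < t"
    and ev: "\<forall>\<^sub>F k in sequentially. r k powr s \<le> measure \<nu> (cball x (K * r k))"
  shows "\<forall>\<^sub>F R in at_right 0. R powr t \<le> measure \<nu> (cball x R)"
proof -
  interpret finite_measure \<nu> by fact
  obtain k0 where k0: "\<And>k. k0 \<le> k \<Longrightarrow> r k powr s \<le> measure \<nu> (cball x (K * r k))"
    using ev by (auto simp: eventually_sequentially)
  define R0 where "R0 = min (K * r k0) ((c / K) powr (s / (t - s)))"
  have R0: "0 < R0" using K c r(1)[of k0] by (simp add: R0_def)
  have "R powr t \<le> measure \<nu> (cball x R)" if R: "0 < R" "R < R0" for R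
  proof -
    have "(\<lambda>k. K * r k) \<longlonglongrightarrow> K * 0" by (intro tendsto_intros r)
    then have "\<forall>\<^sub>F k in sequentially. K * r k < R"
      using R(1) order_tendstoD(2)[of "\<lambda>k. K * r k" 0 sequentially R] by simp
    then obtain k2 where "\<And>k. k2 \<le> k \<Longrightarrow> K * r k < R"
      by (auto simp: eventually_sequentially)
    then have k1: "k0 \<le> max k0 k2" "K * r (max k0 k2) \<le> R"
      by (auto intro: less_imp_le)
    \<comment> \<open>The least index stands in for monotonicity of \<open>r\<close>: its
      predecessor \<open>j\<close> still has \<open>K * r j > R\<close>. The bound
      \<open>R < K * r k0\<close> ensures that this predecessor is at least
      \<open>k0\<close>.\<close>
    define k where "k = (LEAST k. k0 \<le> k \<and> K * r k \<le> R)"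
    have k: "k0 \<le> k" "K * r k \<le> R"
      using LeastI[of "\<lambda>k. k0 \<le> k \<and> K * r k \<le> R" "max k0 k2"] k1 by (auto simp: k_def)
    have "k \<noteq> k0" using k(2) R by (auto simp: R0_def)
    then obtain j where j: "k = Suc j" "k0 \<le> j" using k(1) by (cases k) auto
    have "\<not> K * r j \<le> R"
      using not_less_Least[of j "\<lambda>k. k0 \<le> k \<and> K * r k \<le> R"] j by (auto simp: k_def)
    then have "R / K < r j" using K by (simp add: field_simps)
    then have "c * (R / K) \<le> c * r j" using c(1) by (intro mult_left_mono) auto
    then have rk: "c / K * R \<le> r k" using c(2)[of j] j(1) by simp
    have "R powr (t - s) \<le> R0 powr (t - s)"
      using R s by (intro powr_mono2) auto
    also have "\<dots> \<le> ((c / K) powr (s / (t - s))) powr (t - s)"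
      using s R0 by (intro powr_mono2) (auto simp: R0_def)
    also have "\<dots> = (c / K) powr s"
      using s by (simp add: powr_powr)
    finally have "R powr (t - s) \<le> (c / K) powr s" .
    then have "R powr s * R powr (t - s) \<le> R powr s * (c / K) powr s"
      by (rule mult_left_mono) simp
    also have "R powr s * R powr (t - s) = R powr t"
      by (simp flip: powr_add)
    also have "R powr s * (c / K) powr s = (c / K * R) powr s"
      using R K c(1) by (subst mult.commute, subst powr_mult) auto
    finally have "R powr t \<le> (c / K * R) powr s" .
    also have "\<dots> \<le> r k powr s"
      using rk s R K c by (intro powr_mono2) auto
    also have "\<dots> \<le> measure \<nu> (cball x (K * r k))" by (rule k0[OF k(1)])
    also have "\<dots> \<le> measure \<nu> (cball x R)"
      using k(2) by (intro finite_measure_mono) (auto simp: sets)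
    finally show ?thesis .
  qed
  then show ?thesis
    unfolding eventually_at_right_field using R0 by blast
qed

section \<open>From lower bounds for balls to the upper local dimension\<close>

lemma upper_local_dim_le:
  fixes x :: "real ^ 'n"
  assumes "\<And>t. s < t \<Longrightarrow> \<forall>\<^sub>F R in at_right 0. R powr t \<le> measure \<nu> (cball x R)"
  shows "upper_local_dim \<nu> x \<le> ereal s"
proof (rule ereal_le_epsilon2)
  fix e :: real assume "0 < e"
  then have "\<forall>\<^sub>F R in at_right 0. R powr (s + e) \<le> measure \<nu> (cball x R)"
    using assms by simp
  moreover have "\<forall>\<^sub>F R in at_right (0::real). R < 1"
    by (auto simp: eventually_at_right_field intro: exI[of _ 1])
  moreover have "\<forall>\<^sub>F R in at_right (0::real). 0 < R"
    by (rule eventually_at_right_less)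
  ultimately have "\<forall>\<^sub>F R in at_right 0. (if measure \<nu> (cball x R) = 0 then \<infinity>
      else ereal (ln (measure \<nu> (cball x R)) / ln R)) \<le> ereal (s + e)"
  proof eventually_elim
    case (elim R)
    \<comment> \<open>Positivity rules out the infinite branch; below, division by
      \<open>ln R < 0\<close> reverses the inequality.\<close>
    have pos: "0 < R powr (s + e)" "0 < measure \<nu> (cball x R)"
      using elim by (auto intro: less_le_trans[OF _ elim(1)])
    then have "ln (R powr (s + e)) \<le> ln (measure \<nu> (cball x R))"
      using elim(1) pos by (subst ln_le_cancel_iff) auto
    then have "(s + e) * ln R \<le> ln (measure \<nu> (cball x R))"
      using elim by (simp add: ln_powr)
    then have "ln (measure \<nu> (cball x R)) / ln R \<le> s + e"
      using elim by (simp add: neg_divide_le_eq)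
    then show ?case using pos elim(1) by auto
  qed
  then have "upper_local_dim \<nu> x \<le> ereal (s + e)"
    unfolding upper_local_dim_def by (rule Limsup_bounded)
  then show "upper_local_dim \<nu> x \<le> ereal s + ereal e" by simp
qed

text \<open>Balls around points converging to \<open>x\<close> lie in slightly larger balls around
  \<open>x\<close>, and continuity from above lets their radius shrink to \<open>r\<close>.
  Closedness supplies measurability of conditions on balls of a fixed radius.\<close>

lemma closed_large_balls:
  fixes \<nu> :: "'a::euclidean_space measure"
  assumes "finite_measure \<nu>" and sets: "sets \<nu> = sets borel"
  shows "closed {x. t \<le> measure \<nu> (cball x r)}"
  unfolding closed_sequential_limits
proof (intro allI impI, elim conjE)
  interpret finite_measure \<nu> by fact
  fix f x assume f: "\<forall>n. f n \<in> {x. t \<le> measure \<nu> (cball x r)}" "f \<longlonglongrightarrow> x"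
  define A where "A n = cball x (r + 1 / real (Suc n))" for n
  have A: "range A \<subseteq> sets \<nu>" "decseq A"
  proof -
    show "range A \<subseteq> sets \<nu>" by (auto simp: A_def sets)
    have "A (Suc n) \<subseteq> A n" for n
      unfolding A_def by (intro subset_cball add_left_mono divide_left_mono) auto
    then show "decseq A" by (rule decseq_SucI)
  qed
  have "(\<Inter>n. A n) = cball x r"
  proof (intro equalityI subsetI)
    fix z assume z: "z \<in> (\<Inter>n. A n)"
    have "dist x z \<le> r + 1 / real (Suc n)" for n
      using z by (auto simp: A_def)
    moreover have "(\<lambda>n. r + 1 / real (Suc n)) \<longlonglongrightarrow> r + 0"
      by (intro tendsto_intros LIMSEQ_Suc lim_1_over_n)
    ultimately have "dist x z \<le> r + 0"
      by (intro LIMSEQ_le_const) auto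
    then show "z \<in> cball x r" by simp
  qed (auto simp: A_def intro: add_increasing2)
  then have "(\<lambda>n. measure \<nu> (A n)) \<longlonglongrightarrow> measure \<nu> (cball x r)"
    using finite_Lim_measure_decseq[OF A] by simp
  moreover have "t \<le> measure \<nu> (A n)" for n
  proof -
    have "\<forall>\<^sub>F j in sequentially. dist (f j) x < 1 / real (Suc n)"
      by (rule tendstoD[OF f(2)]) simp
    then obtain j where j: "dist (f j) x < 1 / real (Suc n)"
      by (auto simp: eventually_sequentially)
    have "t \<le> measure \<nu> (cball (f j) r)" using f(1) by simp
    also have "\<dots> \<le> measure \<nu> (A n)"
    proof (rule finite_measure_mono)
      show "cball (f j) r \<subseteq> A n"
      proof
        fix z assume "z \<in> cball (f j) r"
        then show "z \<in> A n"
          using j dist_triangle[of x z "f j"] by (simp add: A_def dist_commute)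
      qed
    qed (auto simp: A_def sets)
    finally show ?thesis .
  qed
  ultimately show "x \<in> {x. t \<le> measure \<nu> (cball x r)}"
    by (auto intro: LIMSEQ_le_const)
qed

text \<open>
  The upper local dimension is not visibly measurable. The lower bounds at dyadic radii are, and
  this transfers them from the domain of \<open>X\<close> to its distribution.
\<close>

lemma AE_distr_upper_local_dim_le:
  fixes X :: "'a \<Rightarrow> real ^ 'n"
  assumes M: "prob_space M" and X[measurable]: "X \<in> borel_measurable M" and d: "0 \<le> d"
    and ball: "\<And>t. d < t \<Longrightarrow> AE i in M. \<forall>\<^sub>F R in at_right 0.
      R powr t \<le> measure (distr M borel X) (cball (X i) R)"
  shows "AE x in distr M borel X. upper_local_dim (distr M borel X) x \<le> ereal d"
proof -
  interpret prob_space M by fact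
  let ?\<nu> = "distr M borel X"
  interpret \<nu>: prob_space ?\<nu> by (rule prob_space_distr) simp
  \<comment> \<open>Countably many exponents suffice, since every \<open>t > d\<close> exceeds one
    of them; a single null set then serves all \<open>t\<close>.\<close>
  define P where "P n x \<longleftrightarrow> (\<forall>\<^sub>F k in sequentially.
    ((1/2) ^ k) powr (d + 1 / real (Suc n)) \<le> measure ?\<nu> (cball x ((1/2) ^ k)))" for n x
  have large: "Measurable.pred borel (\<lambda>x. t \<le> measure ?\<nu> (cball x r))" for t r
    using closed_large_balls[OF \<nu>.finite_measure_axioms, of t r] by (simp add: pred_def borel_closed)
  have [measurable]: "Measurable.pred borel (P n)" for n
    unfolding P_def eventually_sequentially by (intro pred_intros_countable pred_intros_imp' large)
  have half: "filterlim (\<lambda>k. (1/2::real) ^ k) (at_right 0) sequentially"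
    by (intro tendsto_imp_filterlim_at_right LIMSEQ_realpow_zero) auto
  have "AE i in M. P n (X i)" for n
    using ball[of "d + 1 / real (Suc n)"]
  proof (rule AE_mp)
    show "AE i in M. (\<forall>\<^sub>F R in at_right 0. R powr (d + 1 / real (Suc n)) \<le> measure ?\<nu> (cball (X i) R)) \<longrightarrow> P n (X i)"
      unfolding P_def using eventually_compose_filterlim[OF _ half] by (intro AE_I2 impI) auto
  qed simp
  then have "AE x in ?\<nu>. P n x" for n
    by (subst AE_distr_iff) auto
  then have "AE x in ?\<nu>. \<forall>n. P n x"
    by (simp add: AE_all_countable)
  then show ?thesis
  proof (rule AE_mp, intro AE_I2 impI)
    fix x assume P: "\<forall>n. P n x"
    show "upper_local_dim ?\<nu> x \<le> ereal d"
    proof (rule upper_local_dim_le)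
      fix t assume "d < t"
      then obtain n where n: "1 / real (Suc n) < t - d"
        using nat_approx_posE[of "t - d"] by auto
      show "\<forall>\<^sub>F R in at_right 0. R powr t \<le> measure ?\<nu> (cball x R)"
      proof (rule eventually_ball_lower_bound[where r = "\<lambda>k. (1/2) ^ k" and c = "1/2" and K = 1
            and s = "d + 1 / real (Suc n)"])
        show "(\<lambda>k. (1/2::real) ^ k) \<longlonglongrightarrow> 0" by (intro LIMSEQ_realpow_zero) auto
        show "\<forall>\<^sub>F k in sequentially. ((1/2) ^ k) powr (d + 1 / real (Suc n)) \<le>
            measure ?\<nu> (cball x (1 * (1/2) ^ k))"
          using P by (simp add: P_def)
      qed (use d n \<nu>.finite_measure_axioms in auto)
    qed
  qed
qed


subsection \<open>The coding map\<close>

locale almost_self_affine = gibbs_system m T \<mu>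
  for m :: nat and T :: "nat \<Rightarrow> real ^ 'n \<Rightarrow> real ^ 'n" and \<mu> :: "(nat \<Rightarrow> nat) measure" +
  fixes \<omega> :: "nat list \<Rightarrow> real ^ 'n" and B :: "(real ^ 'n) set"
  assumes B: "B \<noteq> {}" "compact B"
    and invariant: "\<And>k w. 1 \<le> k \<Longrightarrow> w \<in> words m k \<Longrightarrow> (\<lambda>x. T (last w) x + \<omega> w) ` B \<subseteq> B"
begin

abbreviation X :: "(nat \<Rightarrow> nat) \<Rightarrow> real ^ 'n" where
  "X \<equiv> code_proj T \<omega>"

lemma step_invariant:
  assumes "i \<in> code_space m" "b \<in> B"
  shows "T (i k) b + \<omega> (initial_seg i (Suc k)) \<in> B"
  using invariant[of "Suc k" "initial_seg i (Suc k)"] initial_seg_words[OF assms(1), of "Suc k"] assms(2)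
  by (auto simp: initial_seg_Suc)

lemma bounded_B:
  obtains R where "0 < R" "B \<subseteq> cball 0 R"
  using compact_imp_bounded[OF B(2)] by (auto simp: bounded_pos subset_iff)

text \<open>Both \<open>T (i k) b\<close> and its translate lie in the ball of radius
  \<open>R\<close>, so the translations along \<open>i\<close> are bounded by \<open>2 * R\<close>
  and the series is dominated by a geometric one.\<close>

lemma sums_code_proj:
  assumes i: "i \<in> code_space m"
  shows "(\<lambda>k. word_map T (initial_seg i k) (\<omega> (initial_seg i (Suc k)))) sums X i"
proof -
  obtain R where R: "0 < R" "B \<subseteq> cball 0 R" by (rule bounded_B)
  obtain \<beta> c where \<beta>: "0 < c" "0 < \<beta>" "\<beta> < 1"
    and bnd: "\<And>i x. i \<in> {1..m} \<Longrightarrow> c * norm x \<le> norm (T i x)"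
      "\<And>i x. i \<in> {1..m} \<Longrightarrow> norm (T i x) \<le> \<beta> * norm x"
    using contraction_constants by metis
  obtain b where b: "b \<in> B" using B(1) by blast
  have "norm (word_map T (initial_seg i k) (\<omega> (initial_seg i (Suc k)))) \<le> \<beta> ^ k * (2 * R)" for k
  proof -
    have ik: "i k \<in> {1..m}" using i by (simp add: code_space_def)
    have "norm (T (i k) b) \<le> 1 * norm b"
      using bnd(2)[OF ik, of b] \<beta> mult_right_mono[of \<beta> 1 "norm b"] by simp
    moreover have "norm b \<le> R" using b R(2) by auto
    moreover have "norm (T (i k) b + \<omega> (initial_seg i (Suc k))) \<le> R"
      using step_invariant[OF i b, of k] R(2) by auto
    ultimately have "norm (\<omega> (initial_seg i (Suc k))) \<le> 2 * R"
      using norm_triangle_ineq4[of "T (i k) b + \<omega> (initial_seg i (Suc k))" "T (i k) b"] by simp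
    then have "\<beta> ^ k * norm (\<omega> (initial_seg i (Suc k))) \<le> \<beta> ^ k * (2 * R)"
      using \<beta> by (intro mult_left_mono) auto
    moreover have "norm (word_map T (initial_seg i k) y) \<le> \<beta> ^ k * norm y" for y
      using word_map_bounds(2)[OF \<beta>(1,2) bnd words_lists[OF initial_seg_words[OF i, of k]], of y]
      by simp
    ultimately show ?thesis by (meson order_trans)
  qed
  moreover have "summable (\<lambda>k. \<beta> ^ k * (2 * R))"
    using \<beta> by (intro summable_mult2 summable_geometric) simp
  ultimately have "summable (\<lambda>k. word_map T (initial_seg i k) (\<omega> (initial_seg i (Suc k))))"
    by (rule summable_comparison_test'[rotated])
  then show ?thesis
    unfolding code_proj_def by (rule summable_sums)
qed

text \<open>A partial sum completed by the image of a point of \<open>B\<close> lies in the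
  translate by \<open>z\<close> of the image of \<open>B\<close> under \<open>word_map T w\<close>:
  invariance absorbs the letters after \<open>w\<close> one at a time, the last one first. The
  completing term tends to 0, and the compact image is closed under the limit.\<close>

lemma code_proj_cylinder:
  assumes w: "w \<in> words m k"
  obtains z where "X ` cylinder m w \<subseteq> (+) z ` word_map T w ` B"
proof
  define z where "z = (\<Sum>j<k. word_map T (take j w) (\<omega> (take (Suc j) w)))"
  show "X ` cylinder m w \<subseteq> (+) z ` word_map T w ` B"
  proof clarify
    fix i assume "i \<in> cylinder m w"
    then have i: "i \<in> code_space m" and iw: "initial_seg i k = w"
      using w by (auto simp: cylinder_def words_def)
    define S where "S n = (\<Sum>j<n. word_map T (initial_seg i j) (\<omega> (initial_seg i (Suc j))))" for n
    have Sk: "S k = z"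
      unfolding S_def z_def iw[symmetric] by (intro sum.cong) (auto simp: take_initial_seg)
    have tail: "\<exists>y\<in>B. S (k + n) + word_map T (initial_seg i (k + n)) b = z + word_map T w y"
      if "b \<in> B" for n b
      using that
    proof (induction n arbitrary: b)
      case 0
      then show ?case using iw Sk by auto
    next
      case (Suc n)
      have lin: "linear (word_map T (initial_seg i (k + n)))"
        using word_map_linear words_lists[OF initial_seg_words[OF i]] by blast
      obtain y where y: "y \<in> B" "S (k + n) + word_map T (initial_seg i (k + n))
          (T (i (k + n)) b + \<omega> (initial_seg i (Suc (k + n)))) = z + word_map T w y"
        using Suc.IH[OF step_invariant[OF i Suc.prems]] by blast
      have "S (k + Suc n) + word_map T (initial_seg i (k + Suc n)) b = z + word_map T w y"
        using y(2) by (simp add: S_def linear_add[OF lin] initial_seg_Suc[of i "k + n"] word_map_append add_ac)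
      then show ?case using y(1) by blast
    qed
    obtain \<beta> c where \<beta>: "0 < c" "0 < \<beta>" "\<beta> < 1"
      and bnd: "\<And>i x. i \<in> {1..m} \<Longrightarrow> c * norm x \<le> norm (T i x)"
        "\<And>i x. i \<in> {1..m} \<Longrightarrow> norm (T i x) \<le> \<beta> * norm x"
      using contraction_constants by metis
    obtain b where b: "b \<in> B" using B(1) by blast
    have "(\<lambda>n. word_map T (initial_seg i n) b) \<longlonglongrightarrow> 0"
    proof (rule Lim_null_comparison)
      show "\<forall>\<^sub>F n in sequentially. norm (word_map T (initial_seg i n) b) \<le> \<beta> ^ n * norm b"
        using word_map_bounds(2)[OF \<beta>(1,2) bnd words_lists[OF initial_seg_words[OF i]], where x = b]
        by (intro always_eventually) simp
      have "(\<lambda>n. \<beta> ^ n * norm b) \<longlonglongrightarrow> 0 * norm b"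
        using \<beta> by (intro tendsto_intros LIMSEQ_realpow_zero) auto
      then show "(\<lambda>n. \<beta> ^ n * norm b) \<longlonglongrightarrow> 0" by simp
    qed
    moreover have "S \<longlonglongrightarrow> X i"
      using sums_code_proj[OF i] by (simp add: sums_def S_def[abs_def])
    ultimately have "(\<lambda>n. S n + word_map T (initial_seg i n) b) \<longlonglongrightarrow> X i + 0"
      by (rule tendsto_add[rotated])
    then have lim: "(\<lambda>n. S (k + n) + word_map T (initial_seg i (k + n)) b) \<longlonglongrightarrow> X i"
      using LIMSEQ_ignore_initial_segment[of "\<lambda>n. S n + word_map T (initial_seg i n) b" "X i" k]
      by (simp add: add.commute)
    have clos: "closed ((+) z ` word_map T w ` B)"
      using word_map_linear[OF words_lists[OF w]] B(2)
      by (intro compact_imp_closed compact_translation compact_continuous_image linear_continuous_on)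
        (auto simp: linear_conv_bounded_linear)
    have "S (k + n) + word_map T (initial_seg i (k + n)) b \<in> (+) z ` word_map T w ` B" for n
      using tail[OF b, of n] by auto
    then show "X i \<in> (+) z ` word_map T w ` B"
      by (rule closed_sequentially[OF clos _ lim])
  qed
qed

lemma code_proj_cylinder_cover:
  obtains R where "0 < R"
    "\<And>w k F d. w \<in> words m k \<Longrightarrow> finite F \<Longrightarrow> word_map T w ` cball 0 1 \<subseteq> (\<Union>y\<in>F. cball y d) \<Longrightarrow>
      \<exists>G. finite G \<and> card G \<le> card F \<and> X ` cylinder m w \<subseteq> (\<Union>y\<in>G. cball y (R * d))"
proof -
  obtain R where R: "0 < R" "B \<subseteq> cball 0 R" by (rule bounded_B)
  show thesis
  proof (rule that[OF R(1)])
    fix w k F d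
    assume w: "w \<in> words m k" and F: "finite F" "word_map T w ` cball 0 1 \<subseteq> (\<Union>y\<in>F. cball y d)"
    obtain z where z: "X ` cylinder m w \<subseteq> (+) z ` word_map T w ` B"
      by (rule code_proj_cylinder[OF w])
    have lin: "linear (word_map T w)"
      using word_map_linear[OF words_lists[OF w]] by blast
    define G where "G = (\<lambda>y. z + R *\<^sub>R y) ` F"
    have "X ` cylinder m w \<subseteq> (+) z ` word_map T w ` cball 0 R"
      using z R(2) by blast
    also have "\<dots> \<subseteq> (+) z ` (\<Union>y\<in>F. cball (R *\<^sub>R y) (R * d))"
      using linear_image_cball[OF lin R(1) F(2), of 0] linear_0[OF lin] by (intro image_mono) simp
    also have "\<dots> = (\<Union>y\<in>G. cball y (R * d))"
      by (simp add: G_def image_UN) (simp add: add.commute)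
    finally show "\<exists>G. finite G \<and> card G \<le> card F \<and> X ` cylinder m w \<subseteq> (\<Union>y\<in>G. cball y (R * d))"
      using F(1) by (intro exI[of _ G]) (auto simp: G_def card_image_le)
  qed
qed

lemma measurable_initial_seg: "(\<lambda>i. initial_seg i k) \<in> measurable \<mu> (count_space (words m k))"
proof (subst measurable_count_space_eq2[OF finite_words], intro conjI ballI)
  show "(\<lambda>i. initial_seg i k) \<in> space \<mu> \<rightarrow> words m k"
    using initial_seg_words by (auto simp: space_\<mu>)
  fix w assume "w \<in> words m k"
  then have "(\<lambda>i. initial_seg i k) -` {w} \<inter> space \<mu> = cylinder m w"
    by (auto simp: cylinder_def space_\<mu> words_def)
  then show "(\<lambda>i. initial_seg i k) -` {w} \<inter> space \<mu> \<in> sets \<mu>" by simp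
qed

text \<open>Each term depends on finitely many letters only and so factors through a finite discrete
  set of words.\<close>

lemma measurable_code_proj [measurable]: "X \<in> borel_measurable \<mu>"
proof -
  have "(\<lambda>i. word_map T (initial_seg i k) (\<omega> (initial_seg i (Suc k)))) \<in> borel_measurable \<mu>" for k
  proof -
    have "(\<lambda>w. word_map T (take k w) (\<omega> w)) \<in> borel_measurable (count_space (words m (Suc k)))"
      by simp
    from measurable_compose[OF measurable_initial_seg this] show ?thesis
      by (simp add: take_initial_seg)
  qed
  then show ?thesis
    unfolding code_proj_def[abs_def] by (intro borel_measurable_suminf)
qed

section \<open>Almost sure lower bounds for balls centred at coded points\<close>

lemma ball_lower_bound_of_summable_Z:
  assumes s: "0 < s" "s \<le> real CARD('n)" and q: "0 < q" "q < 1" and sum: "summable (Z s q)" and t: "s < t"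
  shows "AE i in \<mu>. \<forall>\<^sub>F R in at_right 0. R powr t \<le> measure (distr \<mu> borel X) (cball (X i) R)"
proof -
  define N where "N = real CARD('n)"
  \<comment> \<open>Counted from 0, so that \<open>a w\<close> is the radius at which
    \<open>sv_fun_covering\<close> works.\<close>
  define l where "l = nat \<lceil>s\<rceil> - 1"
  have l: "l < CARD('n)" using s unfolding l_def by linarith
  define a where "a w = singular_values (word_map T w) ! l" for w
  obtain R where R: "0 < R"
    and cover: "\<And>w k F d. w \<in> words m k \<Longrightarrow> finite F \<Longrightarrow> word_map T w ` cball 0 1 \<subseteq> (\<Union>y\<in>F. cball y d) \<Longrightarrow>
      \<exists>G. finite G \<and> card G \<le> card F \<and> X ` cylinder m w \<subseteq> (\<Union>y\<in>G. cball y (R * d))"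
    using code_proj_cylinder_cover by metis
  obtain \<beta> c where \<beta>: "0 < c" "0 < \<beta>" "\<beta> < 1"
    and bnd: "\<And>i x. i \<in> {1..m} \<Longrightarrow> c * norm x \<le> norm (T i x)"
      "\<And>i x. i \<in> {1..m} \<Longrightarrow> norm (T i x) \<le> \<beta> * norm x"
    using contraction_constants by metis
  have lin: "linear (word_map T w)" "inj (word_map T w)" if "w \<in> words m k" for w k
    using word_map_linear[OF words_lists[OF that]] by auto
  have "\<exists>G. finite G \<and> real (card G) * a w powr s \<le> 5 ^ CARD('n) * sv_fun s (word_map T w) \<and>
      X ` cylinder m w \<subseteq> (\<Union>y\<in>G. cball y (R * (N * a w)))" if w: "w \<in> words m k" for w k
  proof -
    obtain F where F: "finite F" "word_map T w ` cball 0 1 \<subseteq> (\<Union>y\<in>F. cball y (N * a w))"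
      "real (card F) * a w powr s \<le> 5 ^ CARD('n) * sv_fun s (word_map T w)"
      using sv_fun_covering[OF lin[OF w] s] unfolding N_def a_def l_def by metis
    obtain G where G: "finite G" "card G \<le> card F" "X ` cylinder m w \<subseteq> (\<Union>y\<in>G. cball y (R * (N * a w)))"
      using cover[OF w F(1,2)] by blast
    have "real (card G) * a w powr s \<le> real (card F) * a w powr s"
      using G(2) by (intro mult_right_mono) auto
    then show ?thesis using F(3) G by (intro exI[of _ G]) simp
  qed
  then obtain G where G: "\<And>w k. w \<in> words m k \<Longrightarrow> finite (G w)"
    "\<And>w k. w \<in> words m k \<Longrightarrow> real (card (G w)) * a w powr s \<le> 5 ^ CARD('n) * sv_fun s (word_map T w)"
    "\<And>w k. w \<in> words m k \<Longrightarrow> X ` cylinder m w \<subseteq> (\<Union>y\<in>G w. cball y (R * (N * a w)))"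
    by metis
  \<comment> \<open>The constant of the ellipsoid cover; its power is a common factor of all
    \<open>e w\<close> and leaves summability untouched.\<close>
  define D where "D = (5::real) ^ CARD('n)"
  define e where "e w = D powr (1 - q) *
    (sv_fun s (word_map T w) powr (1 - q) * prob (cylinder m w) powr q)" for w
  have "AE i in \<mu>. \<forall>\<^sub>F k in sequentially. \<forall>w\<in>words m k. i \<in> cylinder m w \<longrightarrow>
    a w powr s \<le> measure (distr \<mu> borel X) (cball (X i) (2 * (R * (N * a w))))"
  proof (rule AE_eventually_large_balls[where F = "\<lambda>k. G" and e = "\<lambda>k. e"])
    show "prob_space \<mu>" by (rule prob_space_axioms)
    show "summable (\<lambda>k. \<Sum>w\<in>words m k. e w)"
      using summable_mult[OF sum, of "D powr (1 - q)"] by (simp add: e_def Z_def sum_distrib_left)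
    fix k w assume w: "w \<in> words m k"
    text \<open>A minimum is at most a weighted geometric mean.\<close>
    define x where "x = min (prob (cylinder m w)) (real (card (G w)) * a w powr s)"
    have x: "0 \<le> x" "x \<le> prob (cylinder m w)" "x \<le> D * sv_fun s (word_map T w)"
      using G(2)[OF w] by (auto simp: x_def D_def)
    have sv: "0 < sv_fun s (word_map T w)" using word_sv_fun_pos[OF w] s by simp
    have "x = x powr (1 - q) * x powr q"
      using x(1) by (simp flip: powr_add)
    also have "\<dots> \<le> (D * sv_fun s (word_map T w)) powr (1 - q) * prob (cylinder m w) powr q"
      using x q by (intro mult_mono powr_mono2) auto
    also have "\<dots> = e w"
      using sv by (simp add: e_def D_def powr_mult)
    finally show "min (prob (cylinder m w)) (real (card (G w)) * a w powr s) \<le> e w"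
      by (simp add: x_def)
  qed (use G finite_words in auto)
  then show ?thesis
  proof (rule AE_mp, intro AE_I2 impI)
    fix i assume "i \<in> space \<mu>"
      and ev: "\<forall>\<^sub>F k in sequentially. \<forall>w\<in>words m k. i \<in> cylinder m w \<longrightarrow>
        a w powr s \<le> measure (distr \<mu> borel X) (cball (X i) (2 * (R * (N * a w))))"
    then have i: "i \<in> code_space m" by (simp add: space_\<mu>)
    note seg = initial_seg_words[OF i]
    note lists = words_lists[OF seg]
    define r where "r k = a (initial_seg i k)" for k
    have r_bounds: "0 < r k" "r k \<le> \<beta> ^ k" for k
      using singular_value_bounds[OF lin[OF seg] l word_map_bounds(1)[OF \<beta>(1,2) bnd lists]
          word_map_bounds(2)[OF \<beta>(1,2) bnd lists], of k]
      by (auto simp: r_def a_def)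
    show "\<forall>\<^sub>F R in at_right 0. R powr t \<le> measure (distr \<mu> borel X) (cball (X i) R)"
    \<comment> \<open>In \<open>K\<close> the 2 comes from centring the balls, \<open>R\<close> from
      the size of \<open>B\<close> and \<open>N\<close> from the grid cover.\<close>
    proof (rule eventually_ball_lower_bound[where r = r and c = c and K = "2 * (R * N)" and s = s])
      show "finite_measure (distr \<mu> borel X)"
        by (intro finite_measure_distr) simp
      show "r \<longlonglongrightarrow> 0"
      proof (rule Lim_null_comparison)
        show "\<forall>\<^sub>F k in sequentially. norm (r k) \<le> \<beta> ^ k"
          using r_bounds by (intro always_eventually) (auto simp: less_imp_le)
        show "(\<lambda>k. \<beta> ^ k) \<longlonglongrightarrow> 0" using \<beta> by (intro LIMSEQ_realpow_zero) auto
      qed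
      \<comment> \<open>The new letter composes with \<open>T (i k)\<close> on the right, and this
        map shrinks no vector by more than the factor \<open>c\<close>.\<close>
      show "c * r k \<le> r (Suc k)" for k
      proof -
        have ik: "i k \<in> {1..m}" using i by (simp add: code_space_def)
        then have "linear (T (i k))" "inj (T (i k))"
          using contr by (auto simp: linear_contraction_def bij_is_inj)
        from singular_value_comp_ge[OF lin[OF seg] this _ bnd(1)[OF ik] l] show ?thesis
          using \<beta> by (simp add: r_def a_def initial_seg_Suc word_map_append)
      qed
      show "\<forall>\<^sub>F k in sequentially. r k powr s \<le> measure (distr \<mu> borel X) (cball (X i) (2 * (R * N) * r k))"
        using ev
      proof eventually_elim
        case (elim k)
        then show ?case
          using seg[of k] i by (simp add: r_def cylinder_def mult.assoc)
      qed
    qed (use r_bounds \<beta> R s t in \<open>auto simp: N_def\<close>)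
  qed
qed

lemma ball_lower_bound_above_dimension:
  assumes t: "real CARD('n) < t"
  shows "AE i in \<mu>. \<forall>\<^sub>F R in at_right 0. R powr t \<le> measure (distr \<mu> borel X) (cball (X i) R)"
proof -
  define N where "N = real CARD('n)"
  \<comment> \<open>Above \<open>N\<close> to make the series converge, below \<open>t\<close> to
    absorb constants.\<close>
  define s where "s = (N + t) / 2"
  have s: "N < s" "s < t" using t by (auto simp: s_def N_def)
  obtain R where R: "0 < R"
    and cover: "\<And>w k F d. w \<in> words m k \<Longrightarrow> finite F \<Longrightarrow> word_map T w ` cball 0 1 \<subseteq> (\<Union>y\<in>F. cball y d) \<Longrightarrow>
      \<exists>G. finite G \<and> card G \<le> card F \<and> X ` cylinder m w \<subseteq> (\<Union>y\<in>G. cball y (R * d))"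
    using code_proj_cylinder_cover by metis
  define r where "r k = (1/2::real) ^ k" for k :: nat
  have r: "0 < r k" "r k \<le> 1" for k by (auto simp: r_def power_le_one)
  \<comment> \<open>The identity is the map of the empty word, whose cylinder is the whole code
    space; its ellipsoid is the unit ball.\<close>
  have lin: "linear (id :: real ^ 'n \<Rightarrow> real ^ 'n)" "inj (id :: real ^ 'n \<Rightarrow> real ^ 'n)"
    using word_map_linear[of "[]"] by auto
  have "\<exists>G. finite G \<and> real (card G) * r k powr N \<le> 5 ^ CARD('n) \<and>
      X ` code_space m \<subseteq> (\<Union>y\<in>G. cball y (R * (N * r k)))" for k
  proof -
    obtain v u where svd: "svd (id :: real ^ 'n \<Rightarrow> real ^ 'n) v u (\<lambda>j. singular_values (id :: real ^ 'n \<Rightarrow> real ^ 'n) ! j)"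
      using singular_values_svd[OF lin] by blast
    have sv1: "singular_values (id :: real ^ 'n \<Rightarrow> real ^ 'n) ! j = 1" if "j < CARD('n)" for j
      using singular_value_bounds[OF lin that, of 1 1] by simp
    obtain F where F: "finite F" "(id :: real ^ 'n \<Rightarrow> real ^ 'n) ` cball 0 1 \<subseteq> (\<Union>y\<in>F. cball y (N * r k))"
      "real (card F) \<le> 5 ^ CARD('n) * (\<Prod>j<CARD('n). max 1 (singular_values (id :: real ^ 'n \<Rightarrow> real ^ 'n) ! j / r k))"
      using ellipsoid_cover[OF lin(1) svd r(1)] unfolding N_def by metis
    obtain G where G: "finite G" "card G \<le> card F" "X ` code_space m \<subseteq> (\<Union>y\<in>G. cball y (R * (N * r k)))"
      using cover[of "[]" 0 F "N * r k"] F(1,2) by auto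
    have "(\<Prod>j<CARD('n). max 1 (singular_values (id :: real ^ 'n \<Rightarrow> real ^ 'n) ! j / r k)) = (\<Prod>j<CARD('n). 1 / r k)"
      using r[of k] by (intro prod.cong) (auto simp: sv1 max_def)
    then have "real (card F) \<le> 5 ^ CARD('n) * (1 / r k) ^ CARD('n)"
      using F(3) by simp
    then have "real (card G) \<le> 5 ^ CARD('n) * (1 / r k) ^ CARD('n)"
      using G(2) by linarith
    then have "real (card G) * r k powr N \<le> 5 ^ CARD('n) * (1 / r k) ^ CARD('n) * r k powr N"
      by (intro mult_right_mono) auto
    also have "\<dots> = 5 ^ CARD('n)"
      using r(1)[of k] by (simp add: N_def powr_realpow power_one_over)
    finally show ?thesis using G by blast
  qed
  then obtain G where G: "\<And>k. finite (G k)" "\<And>k. real (card (G k)) * r k powr N \<le> 5 ^ CARD('n)"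
    "\<And>k. X ` code_space m \<subseteq> (\<Union>y\<in>G k. cball y (R * (N * r k)))"
    by metis
  have "AE i in \<mu>. \<forall>\<^sub>F k in sequentially. \<forall>w\<in>{()}. i \<in> code_space m \<longrightarrow>
    r k powr s \<le> measure (distr \<mu> borel X) (cball (X i) (2 * (R * (N * r k))))"
  proof (rule AE_eventually_large_balls[where F = "\<lambda>k w. G k" and
        e = "\<lambda>k w. 5 ^ CARD('n) * ((1/2) powr (s - N)) ^ k"])
    show "prob_space \<mu>" by (rule prob_space_axioms)
    have "(1/2::real) powr (s - N) < 1" using s powr_less_mono2[of "s - N" "1/2" 1] by simp
    then show "summable (\<lambda>k. \<Sum>w\<in>{()}. 5 ^ CARD('n) * ((1/2) powr (s - N)) ^ k)"
      by (simp add: summable_mult summable_geometric)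
    fix k
    \<comment> \<open>The number of balls is at most a constant times \<open>r k powr (- N)\<close>,
      so the surplus \<open>s - N\<close> leaves a geometric series.\<close>
    have "real (card (G k)) * r k powr s = real (card (G k)) * r k powr N * r k powr (s - N)"
      by (simp flip: powr_add)
    also have "\<dots> \<le> 5 ^ CARD('n) * r k powr (s - N)"
      by (intro mult_right_mono G) auto
    also have "r k powr (s - N) = ((1/2) powr (s - N)) ^ k"
      by (simp add: r_def powr_powr mult.commute flip: powr_realpow)
    finally show "min (prob (code_space m)) (real (card (G k)) * r k powr s) \<le>
        5 ^ CARD('n) * ((1/2) powr (s - N)) ^ k"
      by simp
    show "code_space m \<in> sets \<mu>" using sets.top[of \<mu>] by (simp add: space_\<mu>)
  qed (use G in auto)
  then show ?thesis
  proof (rule AE_mp, intro AE_I2 impI)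
    fix i assume i: "i \<in> space \<mu>" and ev: "\<forall>\<^sub>F k in sequentially. \<forall>w\<in>{()}. i \<in> code_space m \<longrightarrow>
      r k powr s \<le> measure (distr \<mu> borel X) (cball (X i) (2 * (R * (N * r k))))"
    show "\<forall>\<^sub>F R in at_right 0. R powr t \<le> measure (distr \<mu> borel X) (cball (X i) R)"
    proof (rule eventually_ball_lower_bound[where r = r and c = "1/2" and K = "2 * (R * N)" and s = s])
      show "finite_measure (distr \<mu> borel X)"
        by (intro finite_measure_distr) simp
      show "r \<longlonglongrightarrow> 0" unfolding r_def[abs_def] by (intro LIMSEQ_realpow_zero) auto
      show "\<forall>\<^sub>F k in sequentially. r k powr s \<le> measure (distr \<mu> borel X) (cball (X i) (2 * (R * N) * r k))"
        using ev i by (simp add: space_\<mu> mult.assoc)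
    qed (use r R s in \<open>auto simp: N_def r_def\<close>)
  qed
qed

end

section \<open>Combination of the bounds by the generalised dimensions and by N\<close>

theorem proposition7p1:
  fixes m :: nat
    and T :: "nat \<Rightarrow> real ^ 'n \<Rightarrow> real ^ 'n"
    and \<mu> :: "(nat \<Rightarrow> nat) measure"
    and \<omega> :: "nat list \<Rightarrow> real ^ 'n"
  assumes "m \<ge> 2"
    and "\<And>i. i \<in> {1..m} \<Longrightarrow> linear_contraction (T i) \<and> bij (T i)"
    and "gibbs_measure m \<mu>"
    and "\<exists>B. B \<noteq> {} \<and> compact B \<and>
           (\<forall>k\<ge>1. \<forall>w\<in>words m k. (\<lambda>x. T (last w) x + \<omega> w) ` B \<subseteq> B)"
  shows "AE x in proj_measure T \<omega> \<mu>.
           upper_local_dim (proj_measure T \<omega> \<mu>) x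
             \<le> ereal (min (Lim (at_left 1) (\<lambda>q. gen_dim m T \<mu> q)) (real CARD('n)))"
proof -
  obtain B where B: "B \<noteq> {}" "compact B"
    "\<And>k w. 1 \<le> k \<Longrightarrow> w \<in> words m k \<Longrightarrow> (\<lambda>x. T (last w) x + \<omega> w) ` B \<subseteq> B"
    using assms(4) by metis
  interpret almost_self_affine m T \<mu> \<omega> B
  proof
    show "2 \<le> m" by fact
    show "linear_contraction (T i) \<and> bij (T i)" if "i \<in> {1..m}" for i
      using assms(2) that .
    show "gibbs_measure m \<mu>" by fact
    show "B \<noteq> {}" "compact B" by fact+
    show "(\<lambda>x. T (last w) x + \<omega> w) ` B \<subseteq> B" if "1 \<le> k" "w \<in> words m k" for k w
      using B(3) that .
  qed
  define D where "D = Lim (at_left 1) (gen_dim m T \<mu>)"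
  \<comment> \<open>Inherited from positivity of \<open>gen_dim\<close>; it makes the exponent
    \<open>s\<close> chosen below positive.\<close>
  have D: "0 \<le> D"
  proof (rule ccontr)
    assume "\<not> 0 \<le> D"
    then obtain q where "0 < q" "q < 1" "gen_dim m T \<mu> q < 0"
      using gen_dim_less_of_Lim_less[of 0] by (auto simp: D_def)
    then show False using gen_dim(1)[of q] by simp
  qed
  have "AE i in \<mu>. \<forall>\<^sub>F R in at_right 0. R powr t \<le> measure (distr \<mu> borel X) (cball (X i) R)"
    if t: "min D (real CARD('n)) < t" for t
  proof (cases "real CARD('n) < t")
    case True
    then show ?thesis by (rule ball_lower_bound_above_dimension)
  next
    case False
    \<comment> \<open>\<open>D < s\<close> provides a \<open>q\<close> with d_q < s, and
      \<open>s < t\<close> leaves room for constants. As \<open>t\<close> is at most N here,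
      \<open>s\<close> stays in the range of the ellipsoid cover.\<close>
    define s where "s = (D + t) / 2"
    have s: "D < s" "s < t" "s \<le> real CARD('n)" using t False by (auto simp: s_def min_def split: if_splits)
    obtain q where q: "0 < q" "q < 1" "gen_dim m T \<mu> q < s"
      using gen_dim_less_of_Lim_less s(1) by (auto simp: D_def)
    have "0 < s" using s(1) D by simp
    then have "summable (Z s q)"
      using pressure_pos[OF q] q by (intro summable_Z) auto
    with q s \<open>0 < s\<close> show ?thesis by (intro ball_lower_bound_of_summable_Z) auto
  qed
  then have "AE x in distr \<mu> borel X. upper_local_dim (distr \<mu> borel X) x \<le> ereal (min D (real CARD('n)))"
    using D by (intro AE_distr_upper_local_dim_le prob_space_axioms measurable_code_proj) auto
  then show ?thesis unfolding proj_measure_def D_def .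
qed

end
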